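(* Let $w,w':\mathbb{Z}_{\geq 0}\to(0,\infty)$ satisfy $\sum_{k=0}^\infty w(k)=1=\sum_{k=0}^\infty w'(k)$, and let $\alpha,\beta,\mu:\mathbb{Z}_{\geq0}\to\mathbb{C}$ be sequences. Let $H_w$, $H_{w'}$ be the Hilbert spaces and $D$, with maximal domain $\operatorname{dom}(D)\subseteq H_w$, the operator from $H_w$ to $H_{w'}$ given by $Df=U\beta(\mathbb{K})f-fU\alpha(\mathbb{K})$, all as defined in the context. Assume: (i) the limit $\beta_\infty:=\lim_{k\to\infty}(\beta(k+1)-\beta(k))$ exists and $\beta_\infty\neq 0$; (ii) $\sum_{k=0}^\infty|\beta(k)-\alpha(k)|^2\,w'(k)<\infty$; (iii) $\alpha(k)\neq0$ and $\beta(k)\neq 0$ for every $k\ge 0$; (iv) $\mu(0)=1$ and $\alpha(k)=\beta(k)\dfrac{\mu(k+1)}{\mu(k)}$ for all $k\geq 0$ (so $\mu$ is nowhere zero and determined by $\alpha,\beta$); (v) there is a constant $M$ such that for all integers $0\le k\leq j$ and all $n\in\mathbb{Z}_{\geq0}$, $$\left|\frac{\beta(k)\beta(k+1)\cdots\beta(k+n)}{\beta(j)\beta(j+1)\cdots\beta(j+n)}\right|\leq M;$$ (vi) $$\sum_{k=0}^{\infty}\sum_{j=0}^{\infty}\frac{1}{(\max(j,k)+1)^2}\left|\frac{\mu(j)}{\mu(k)}\right|^2\frac{w(k)}{w'(j)}<\infty;$$ (vii) there exists $N\in\mathbb{Z}_{\ge 0}$ such that, for $n\in\mathbb{Z}_{\geq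 0}$, the sum $$\sum_{k=0}^{\infty}\frac{(1+k)^{2n}}{|\mu(k)|^{2}}\,w(k)$$ is finite for $n<N$ and infinite for $n\geq N$. Then $D$ on $\operatorname{dom}(D)$ has a compact parametrix. In fact, there exists a compact operator $Q:H_{w'}\to H_w$ satisfying $DQ=I$ (in particular $\operatorname{Ran}(Q)\subseteq\operatorname{dom}(D)$) and $QD=I-C$ on $\operatorname{dom}(D)$, where $C$ is a compact operator.
   Context: Let $\{E_k\}_{k\ge0}$ be the canonical basis of $\ell^2(\mathbb{Z}_{\geq0})$, let $U$ be the unilateral shift $UE_k=E_{k+1}$, and let $\mathbb{K}$ be the label operator $\mathbb{K}E_k=kE_k$; for $a:\mathbb{Z}_{\geq0}\to\mathbb{C}$, $a(\mathbb{K})$ is the diagonal operator $a(\mathbb{K})E_k=a(k)E_k$. One has $U^*U=I$ and $\mathbb{K}U=U(\mathbb{K}+I)$. $\mathcal{F}$ denotes the space of all formal series $$f=\sum_{n\geq0}U^nf_n(\mathbb{K})+\sum_{n<0}f_n(\mathbb{K})(U^* )^{-n}$$ with arbitrary coefficient functions $f_n:\mathbb{Z}_{\geq0}\to\mathbb{C}$, $n\in\mathbb{Z}$. For a weight $w:\mathbb{Z}_{\geq0}\to(0,\infty)$ with $\sum_k w(k)=1$, $H_w$ is the Hilbert space of all $f\in\mathcal{F}$ with $$\|f\|_w^2=\sum_{n\geq0}\sum_{k\geq0}w(k)|f_n(k)|^2+\sum_{n<0}\sum_{k\geq0}w(k-n)|f_n(k)|^2<\infty .$$ (This is the GNS Hilbert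 space of the Toeplitz algebra $C^*(U)$ for the state $a\mapsto\operatorname{tr}(w(\mathbb{K})a)$.) The space $H_{w'}$ is defined in the same way with $w'$ in place of $w$. Given sequences $\alpha,\beta$, the linear map $D:\mathcal{F}\to\mathcal{F}$ is $Df=U\beta(\mathbb{K})f-fU\alpha(\mathbb{K})$, with the products computed term by term. In coefficients, $(Df)_{n+1}$ depends only on $f_n$: for $n\geq0$, $(Df)_{n+1}(k)=\beta(k+n)f_n(k)-\alpha(k)f_n(k+1)$; for $n<0$, $(Df)_{n+1}(k)=\beta(k-1)f_n(k-1)-\alpha(k-n-1)f_n(k)$, where the term $\beta(k-1)f_n(k-1)$ is read as $0$ when $k=0$. The maximal domain is $\operatorname{dom}(D)=\{f\in H_w: Df\in H_{w'}\}$, and $D$ is regarded as an unbounded operator from $H_w$ to $H_{w'}$ with this domain. A compact parametrix of $D$ is a compact operator $Q:H_{w'}\to H_w$ that inverts $D$ on both sides modulo compact operators. *)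

theory Defs
  imports "HOL-Analysis.Analysis"
begin

text \<open>
  A formal series \<open>\<Sum>\<^sub>n\<^sub>\<ge>\<^sub>0 U\<^sup>n f\<^sub>n(K) + \<Sum>\<^sub>n\<^sub><\<^sub>0 f\<^sub>n(K) (U\<^sup>*)\<^sup>-\<^sup>n\<close> is represented by its
  coefficients: \<open>f n k\<close> is \<open>f\<^sub>n(k)\<close>.
\<close>

type_synonym fseries = "int \<Rightarrow> nat \<Rightarrow> complex"

text \<open>
  The four products below are computed term by term, using \<open>U\<^sup>*U = I\<close>,
  \<open>a(K) U = U a(K + I)\<close>, \<open>U\<^sup>* a(K) = a(K + I) U\<^sup>*\<close>, and the fact that \<open>U a(K) U\<^sup>*\<close> is the
  diagonal operator with entries \<open>0, a(0), a(1), \<dots>\<close>.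
\<close>

definition diag_left :: "(nat \<Rightarrow> complex) \<Rightarrow> fseries \<Rightarrow> fseries" where  (* a(K) f *)
  "diag_left a f = (\<lambda>n k. if n \<ge> 0 then a (k + nat n) * f n k else a k * f n k)"

definition diag_right :: "fseries \<Rightarrow> (nat \<Rightarrow> complex) \<Rightarrow> fseries" where  (* f a(K) *)
  "diag_right f a = (\<lambda>n k. if n \<ge> 0 then f n k * a k else f n k * a (k + nat (- n)))"

definition shift_left :: "fseries \<Rightarrow> fseries" where  (* U f *)
  "shift_left f = (\<lambda>n k. if n > 0 then f (n - 1) k
                         else if k = 0 then 0 else f (n - 1) (k - 1))"

definition shift_right :: "fseries \<Rightarrow> fseries" where  (* f U *)
  "shift_right f = (\<lambda>n k. if n > 0 then f (n - 1) (k + 1) else f (n - 1) k)"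

definition D_op :: "(nat \<Rightarrow> complex) \<Rightarrow> (nat \<Rightarrow> complex) \<Rightarrow> fseries \<Rightarrow> fseries" where
  "D_op \<alpha> \<beta> f =
     (\<lambda>n k. shift_left (diag_left \<beta> f) n k - diag_right (shift_right f) \<alpha> n k)"

lemma D_op_nonneg:
  assumes "n \<ge> 0"
  shows "D_op \<alpha> \<beta> f (n + 1) k = \<beta> (k + nat n) * f n k - \<alpha> k * f n (k + 1)"
  using assms
  by (simp add: D_op_def diag_left_def diag_right_def shift_left_def shift_right_def)

lemma D_op_neg:
  assumes "n < 0"
  shows "D_op \<alpha> \<beta> f (n + 1) k =
    (if k = 0 then 0 else \<beta> (k - 1) * f n (k - 1)) - \<alpha> (k + nat (- n) - 1) * f n k"
proof -
  have "nat (- n) = Suc (nat (- (n + 1)))"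
    using assms by simp
  then show ?thesis
    using assms
    by (auto simp: D_op_def diag_left_def diag_right_def shift_left_def shift_right_def)
qed

definition H_weight :: "(nat \<Rightarrow> real) \<Rightarrow> int \<Rightarrow> nat \<Rightarrow> real" where
  "H_weight w n k = (if n \<ge> 0 then w k else w (k + nat (- n)))"

definition H_space :: "(nat \<Rightarrow> real) \<Rightarrow> fseries set" where
  "H_space w = {f. (\<lambda>(n, k). H_weight w n k * (cmod (f n k))\<^sup>2) summable_on UNIV}"

definition H_norm :: "(nat \<Rightarrow> real) \<Rightarrow> fseries \<Rightarrow> real" where
  "H_norm w f = sqrt (\<Sum>\<^sub>\<infinity>(n, k). H_weight w n k * (cmod (f n k))\<^sup>2)"

definition D_dom ::
    "(nat \<Rightarrow> real) \<Rightarrow> (nat \<Rightarrow> real) \<Rightarrow> (nat \<Rightarrow> complex) \<Rightarrow> (nat \<Rightarrow> complex) \<Rightarrow> fseries set" where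
  "D_dom w w' \<alpha> \<beta> = {f \<in> H_space w. D_op \<alpha> \<beta> f \<in> H_space w'}"

text \<open>
  Operators between these spaces are maps on all formal series of which only the values on
  the domain space matter. Compactness: bounded sequences are mapped to sequences with a
  norm-convergent subsequence (boundedness of the operator follows).
\<close>

definition linear_op :: "(nat \<Rightarrow> real) \<Rightarrow> (nat \<Rightarrow> real) \<Rightarrow> (fseries \<Rightarrow> fseries) \<Rightarrow> bool" where
  "linear_op v w T \<longleftrightarrow>
     (\<forall>f\<in>H_space v. T f \<in> H_space w) \<and>
     (\<forall>f\<in>H_space v. \<forall>g\<in>H_space v. T (\<lambda>n k. f n k + g n k) = (\<lambda>n k. T f n k + T g n k)) \<and>
     (\<forall>c. \<forall>f\<in>H_space v. T (\<lambda>n k. c * f n k) = (\<lambda>n k. c * T f n k))"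

definition compact_op :: "(nat \<Rightarrow> real) \<Rightarrow> (nat \<Rightarrow> real) \<Rightarrow> (fseries \<Rightarrow> fseries) \<Rightarrow> bool" where
  "compact_op v w T \<longleftrightarrow>
     linear_op v w T \<and>
     (\<forall>F :: nat \<Rightarrow> fseries.
        (\<forall>i. F i \<in> H_space v) \<and> (\<exists>B. \<forall>i. H_norm v (F i) \<le> B) \<longrightarrow>
        (\<exists>g\<in>H_space w. \<exists>r. strict_mono r \<and>
           (\<lambda>i. H_norm w (\<lambda>n k. T (F (r i)) n k - g n k)) \<longlonglongrightarrow> 0))"

definition compact_parametrix ::
    "(nat \<Rightarrow> real) \<Rightarrow> (nat \<Rightarrow> real) \<Rightarrow> (nat \<Rightarrow> complex) \<Rightarrow> (nat \<Rightarrow> complex) \<Rightarrow>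
      (fseries \<Rightarrow> fseries) \<Rightarrow> bool" where
  "compact_parametrix w w' \<alpha> \<beta> Q \<longleftrightarrow>
     compact_op w' w Q \<and>
     (\<exists>C'. compact_op w' w' C' \<and>
        (\<forall>g\<in>H_space w'. Q g \<in> D_dom w w' \<alpha> \<beta> \<and> D_op \<alpha> \<beta> (Q g) = (\<lambda>n k. g n k - C' g n k))) \<and>
     (\<exists>C. compact_op w w C \<and>
        (\<forall>f\<in>D_dom w w' \<alpha> \<beta>. Q (D_op \<alpha> \<beta> f) = (\<lambda>n k. f n k - C f n k)))"

end

theory Submission
  imports Defs "HOL-Complex_Analysis.Great_Picard"
begin

text \<open>
  \<open>D\<close> maps the block \<open>f\<^sub>n\<close> to the block \<open>n + 1\<close> by a first order recursion in \<open>k\<close>. Solving it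
  forwards from \<open>k = 0\<close> for \<open>n < 0\<close> and backwards from infinity for \<open>n \<ge> 0\<close> gives a right inverse
  \<open>Q\<^sub>0\<close>, whose matrix entries are bounded through (v) and \<open>|\<beta>(k)| \<ge> c (k + 1)\<close> by the terms of (vi). So every
  block of \<open>Q\<^sub>0\<close> is Hilbert-Schmidt, with norms tending to zero as \<open>|n| \<rightarrow> \<infinity>\<close>, and \<open>Q\<^sub>0\<close> is compact.

  The kernel of \<open>D\<close> in \<open>H\<^sub>w\<close> is trivial in the blocks \<open>n < 0\<close>; in a block \<open>n \<ge> 0\<close> it is spanned by one
  vector, of size about \<open>(1 + k)\<^sup>n / |\<mu>(k)|\<close>, which lies in \<open>H\<^sub>w\<close> exactly for \<open>n < N\<close>. Hence the
  orthogonal projection \<open>P\<close> onto the kernel has finite rank. For \<open>N > 0\<close> the operator \<open>I - Q\<^sub>0 D\<close> is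
  not bounded: it vanishes on finitely supported series and fixes the kernel of \<open>D\<close>. But
  \<open>Q = (I - P) Q\<^sub>0\<close> satisfies \<open>DQ = I\<close> and \<open>QD = I - P\<close>.
\<close>

section \<open>Sums over arbitrary index sets\<close>

lemma nonneg_summable_on_bounded_sums:
  fixes p :: "'a \<Rightarrow> real"
  assumes "\<And>x. p x \<ge> 0" and "\<And>F. finite F \<Longrightarrow> sum p F \<le> B"
  shows "p summable_on UNIV" and "infsum p UNIV \<le> B"
proof -
  show s: "p summable_on UNIV"
    using assms by (intro nonneg_bdd_above_summable_on) (auto simp: bdd_above_def)
  show "infsum p UNIV \<le> B"
    using assms(2) by (intro infsum_le_finite_sums[OF s]) auto
qed

text \<open>A finite set whose sum is within \<open>\<epsilon>\<close> of the total leaves at most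
  \<open>\<epsilon>\<close> for anything disjoint from it. All truncations below rest on
  this.\<close>

lemma summable_on_small_tail:
  fixes p :: "'a \<Rightarrow> real"
  assumes s: "p summable_on UNIV" and pos: "\<And>x. p x \<ge> 0" and e: "\<epsilon> > 0"
  obtains E where "finite E" "\<And>F. finite F \<Longrightarrow> F \<inter> E = {} \<Longrightarrow> sum p F \<le> \<epsilon>"
proof -
  obtain E where E: "finite E" "dist (sum p E) (infsum p UNIV) \<le> \<epsilon>"
    using infsum_finite_approximation[OF s e] by blast
  have "sum p F \<le> \<epsilon>" if "finite F" "F \<inter> E = {}" for F
  proof -
    have "sum p F + sum p E = sum p (F \<union> E)"
      using that E(1) by (simp add: sum.union_disjoint)
    also have "\<dots> \<le> infsum p UNIV"
      using that E(1) pos by (intro finite_sum_le_infsum[OF s]) auto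
    finally show ?thesis using E(2) by (simp add: dist_real_def)
  qed
  then show thesis using that E(1) by blast
qed

lemma summable_on_fibre:
  fixes p :: "'a \<times> 'b \<Rightarrow> real"
  assumes "p summable_on UNIV"
  shows "(\<lambda>y. p (x, y)) summable_on UNIV"
  using summable_on_SigmaD1[of "\<lambda>x y. p (x, y)" UNIV "\<lambda>_. UNIV" x] assms by simp

lemma sum_fibres_le:
  fixes p :: "'a \<times> 'b \<Rightarrow> real"
  assumes s: "p summable_on UNIV" and pos: "\<And>z. p z \<ge> 0" and "finite I"
  shows "(\<Sum>x\<in>I. \<Sum>\<^sub>\<infinity>y. p (x, y)) \<le> infsum p UNIV"
proof -
  have s': "p summable_on (Sigma I (\<lambda>_. UNIV))"
    using s by (rule summable_on_subset_banach) auto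
  have "(\<Sum>x\<in>I. \<Sum>\<^sub>\<infinity>y. p (x, y)) = infsum p (Sigma I (\<lambda>_. UNIV))"
    using infsum_Sigma_banach[OF s'] \<open>finite I\<close> by simp
  also have "\<dots> \<le> infsum p UNIV"
    using s s' pos by (intro infsum_mono_neutral) auto
  finally show ?thesis .
qed

text \<open>The factor \<open>sqrt (V j)\<close> is moved from \<open>c\<close> to \<open>x\<close>,
  so that \<open>x\<close> is measured in the weighted norm and \<open>c\<close> in the dual one. It
  is applied to one row of a kernel and one block of a series.\<close>

lemma weighted_Cauchy_Schwarz:
  fixes c x :: "'a \<Rightarrow> complex" and V :: "'a \<Rightarrow> real"
  assumes V: "\<And>j. V j > 0"
    and c: "(\<lambda>j. (cmod (c j))\<^sup>2 / V j) summable_on UNIV"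
    and x: "(\<lambda>j. V j * (cmod (x j))\<^sup>2) summable_on UNIV"
  shows "(\<lambda>j. c j * x j) summable_on UNIV"
    and "(cmod (\<Sum>\<^sub>\<infinity>j. c j * x j))\<^sup>2
      \<le> (\<Sum>\<^sub>\<infinity>j. (cmod (c j))\<^sup>2 / V j) * (\<Sum>\<^sub>\<infinity>j. V j * (cmod (x j))\<^sup>2)"
proof -
  let ?A = "\<Sum>\<^sub>\<infinity>j. (cmod (c j))\<^sup>2 / V j" and ?B = "\<Sum>\<^sub>\<infinity>j. V j * (cmod (x j))\<^sup>2"
  have A0: "?A \<ge> 0" and B0: "?B \<ge> 0"
    using V by (auto intro!: infsum_nonneg simp: less_imp_le)
  have fin: "(\<Sum>j\<in>F. cmod (c j * x j)) \<le> sqrt (?A * ?B)" if "finite F" for F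
  proof -
    have "(\<Sum>j\<in>F. cmod (c j * x j))
        = (\<Sum>j\<in>F. (cmod (c j) / sqrt (V j)) * (sqrt (V j) * cmod (x j)))"
      using V by (intro sum.cong) (auto simp: norm_mult less_imp_neq[symmetric])
    also have "(\<Sum>j\<in>F. (cmod (c j) / sqrt (V j)) * (sqrt (V j) * cmod (x j)))\<^sup>2
        \<le> (\<Sum>j\<in>F. (cmod (c j) / sqrt (V j))\<^sup>2) * (\<Sum>j\<in>F. (sqrt (V j) * cmod (x j))\<^sup>2)"
      by (rule Cauchy_Schwarz_ineq_sum)
    also have "\<dots> = (\<Sum>j\<in>F. (cmod (c j))\<^sup>2 / V j) * (\<Sum>j\<in>F. V j * (cmod (x j))\<^sup>2)"
      using V by (simp add: power_divide power_mult_distrib less_imp_le)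
    also have "\<dots> \<le> ?A * ?B"
      using V that A0
      by (intro mult_mono finite_sum_le_infsum[OF c] finite_sum_le_infsum[OF x] sum_nonneg)
        (auto simp: less_imp_le)
    finally show ?thesis by (rule real_le_rsqrt)
  qed
  have abs: "(\<lambda>j. cmod (c j * x j)) summable_on UNIV"
    and le: "(\<Sum>\<^sub>\<infinity>j. cmod (c j * x j)) \<le> sqrt (?A * ?B)"
    using nonneg_summable_on_bounded_sums[of "\<lambda>j. cmod (c j * x j)", OF _ fin] by auto
  show "(\<lambda>j. c j * x j) summable_on UNIV"
    using abs by (rule Infinite_Sum.abs_summable_summable)
  have "cmod (\<Sum>\<^sub>\<infinity>j. c j * x j) \<le> sqrt (?A * ?B)"
    using norm_infsum_bound[OF abs] le by linarith
  then have "(cmod (\<Sum>\<^sub>\<infinity>j. c j * x j))\<^sup>2 \<le> (sqrt (?A * ?B))\<^sup>2"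
    by (intro power_mono) auto
  then show "(cmod (\<Sum>\<^sub>\<infinity>j. c j * x j))\<^sup>2 \<le> ?A * ?B"
    using A0 B0 by simp
qed

text \<open>Every finite set of pairs lies in a finite rectangle, where the sum factors. This gives
  the Hilbert-Schmidt norm of a rank one block.\<close>

lemma product_weight_sum:
  fixes p :: "nat \<Rightarrow> real"
  assumes p: "p summable_on UNIV" and p0: "\<And>k. p k \<ge> 0"
  shows "(\<lambda>(k, j). p k * p j) summable_on UNIV"
    and "(\<Sum>\<^sub>\<infinity>(k, j). p k * p j) \<le> (infsum p UNIV)\<^sup>2"
proof -
  have fin: "(\<Sum>(k, j)\<in>F. p k * p j) \<le> (infsum p UNIV)\<^sup>2" if "finite F" for F
  proof -
    have "(\<Sum>(k, j)\<in>F. p k * p j) \<le> (\<Sum>(k, j)\<in>fst ` F \<times> snd ` F. p k * p j)"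
      using that subset_fst_snd[of F] p0 by (intro sum_mono2) auto
    also have "\<dots> = sum p (fst ` F) * sum p (snd ` F)"
      by (simp add: sum_product sum.cartesian_product)
    also have "\<dots> \<le> infsum p UNIV * infsum p UNIV"
      using that p0 by (intro mult_mono finite_sum_le_infsum[OF p] sum_nonneg infsum_nonneg) auto
    finally show ?thesis by (simp add: power2_eq_square)
  qed
  show "(\<lambda>(k, j). p k * p j) summable_on UNIV" "(\<Sum>\<^sub>\<infinity>(k, j). p k * p j) \<le> (infsum p UNIV)\<^sup>2"
    using nonneg_summable_on_bounded_sums[OF _ fin] p0 by auto
qed

lemma infsum_linear_combination:
  fixes f g :: "nat \<Rightarrow> complex"
  assumes "f summable_on UNIV" "g summable_on UNIV"
  shows "x * infsum f UNIV - y * infsum g UNIV = (\<Sum>\<^sub>\<infinity>j. x * f j - y * g j)"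
  using infsum_add[OF summable_on_cmult_right[OF assms(1), of x]
      summable_on_cmult_right[OF assms(2), of "- y"]]
  by (simp add: infsum_cmult_right' infsum_uminus)

lemma infsum_delta: "(\<Sum>\<^sub>\<infinity>j. (if j = k then 1 else 0) * x j) = (x k :: complex)" for k :: nat
proof -
  have "(\<Sum>\<^sub>\<infinity>j. (if j = k then 1 else 0) * x j) = infsum x {k}"
    by (rule infsum_cong_neutral) auto
  then show ?thesis by simp
qed

subsection \<open>The squared norm and a compactness criterion\<close>

definition hsq :: "(nat \<Rightarrow> real) \<Rightarrow> fseries \<Rightarrow> real" where
  "hsq w f = (\<Sum>\<^sub>\<infinity>(n, k). H_weight w n k * (cmod (f n k))\<^sup>2)"

definition pos_weight :: "(nat \<Rightarrow> real) \<Rightarrow> bool" where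
  "pos_weight w \<longleftrightarrow> (\<forall>k. w k > 0)"

lemma H_norm_hsq: "H_norm w f = sqrt (hsq w f)"
  by (simp add: H_norm_def hsq_def)

lemma H_weight_pos: "pos_weight w \<Longrightarrow> H_weight w n k > 0"
  by (simp add: H_weight_def pos_weight_def)

lemma H_term_nonneg: "pos_weight w \<Longrightarrow> H_weight w n k * (cmod (f n k))\<^sup>2 \<ge> 0"
  by (simp add: H_weight_pos less_imp_le)

lemma hsq_nonneg: "pos_weight w \<Longrightarrow> hsq w f \<ge> 0"
  unfolding hsq_def by (rule infsum_nonneg) (auto simp: H_term_nonneg)

lemma H_spaceI:
  assumes "pos_weight w"
    and "\<And>F. finite F \<Longrightarrow> (\<Sum>(n, k)\<in>F. H_weight w n k * (cmod (f n k))\<^sup>2) \<le> B"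
  shows "f \<in> H_space w" and "hsq w f \<le> B"
  using nonneg_summable_on_bounded_sums[of "\<lambda>(n, k). H_weight w n k * (cmod (f n k))\<^sup>2" B] assms
  by (auto simp: H_space_def hsq_def H_term_nonneg)

lemma sum_le_hsq:
  assumes "pos_weight w" "f \<in> H_space w" "finite F"
  shows "(\<Sum>(n, k)\<in>F. H_weight w n k * (cmod (f n k))\<^sup>2) \<le> hsq w f"
  unfolding hsq_def using assms
  by (intro finite_sum_le_infsum) (auto simp: H_space_def H_term_nonneg)

lemma term_le_hsq:
  assumes "pos_weight w" "f \<in> H_space w"
  shows "H_weight w n k * (cmod (f n k))\<^sup>2 \<le> hsq w f"
  using sum_le_hsq[OF assms, of "{(n, k)}"] by simp

text \<open>The constants come from \<open>2ab \<le> a\<^sup>2 + b\<^sup>2\<close> applied termwise.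
  This crude form replaces Minkowski's inequality and stays with squared norms.\<close>

lemma
  assumes w: "pos_weight w" and f: "f \<in> H_space w" and g: "g \<in> H_space w"
  shows H_space_add: "(\<lambda>n k. f n k + g n k) \<in> H_space w"
    and hsq_add_le: "hsq w (\<lambda>n k. f n k + g n k) \<le> 2 * hsq w f + 2 * hsq w g"
proof -
  have tri: "(cmod (a + b))\<^sup>2 \<le> 2 * (cmod a)\<^sup>2 + 2 * (cmod b)\<^sup>2" for a b
  proof -
    have "(cmod (a + b))\<^sup>2 \<le> (cmod a + cmod b)\<^sup>2"
      by (intro power_mono norm_triangle_ineq) auto
    then show ?thesis
      using sum_squares_bound[of "cmod a" "cmod b"] by (simp add: power2_sum)
  qed
  have fin: "(\<Sum>(n, k)\<in>F. H_weight w n k * (cmod (f n k + g n k))\<^sup>2)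
      \<le> 2 * hsq w f + 2 * hsq w g" if "finite F" for F
  proof -
    have "(\<Sum>(n, k)\<in>F. H_weight w n k * (cmod (f n k + g n k))\<^sup>2)
        \<le> (\<Sum>z\<in>F. 2 * (case z of (n, k) \<Rightarrow> H_weight w n k * (cmod (f n k))\<^sup>2)
             + 2 * (case z of (n, k) \<Rightarrow> H_weight w n k * (cmod (g n k))\<^sup>2))"
    proof (rule sum_mono, clarify)
      fix n k
      show "H_weight w n k * (cmod (f n k + g n k))\<^sup>2
        \<le> 2 * (H_weight w n k * (cmod (f n k))\<^sup>2) + 2 * (H_weight w n k * (cmod (g n k))\<^sup>2)"
        using mult_left_mono[OF tri less_imp_le[OF H_weight_pos[OF w]], of n k "f n k" "g n k"]
        by (simp add: algebra_simps)
    qed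
    also have "\<dots> \<le> 2 * hsq w f + 2 * hsq w g"
      using sum_le_hsq[OF w f that] sum_le_hsq[OF w g that]
      by (simp add: sum.distrib flip: sum_distrib_left)
    finally show ?thesis .
  qed
  show "(\<lambda>n k. f n k + g n k) \<in> H_space w"
    "hsq w (\<lambda>n k. f n k + g n k) \<le> 2 * hsq w f + 2 * hsq w g"
    by (rule H_spaceI[OF w fin]; assumption)+
qed

lemma hsq_scale: "hsq w (\<lambda>n k. c * f n k) = (cmod c)\<^sup>2 * hsq w f"
proof -
  have "(\<lambda>(n, k). H_weight w n k * (cmod (c * f n k))\<^sup>2)
      = (\<lambda>z. (cmod c)\<^sup>2 * (case z of (n, k) \<Rightarrow> H_weight w n k * (cmod (f n k))\<^sup>2))"
    by (auto simp: norm_mult power_mult_distrib algebra_simps)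
  then show ?thesis by (simp add: hsq_def infsum_cmult_right')
qed

lemma H_space_scale:
  assumes "f \<in> H_space w"
  shows "(\<lambda>n k. c * f n k) \<in> H_space w"
proof -
  have "(\<lambda>(n, k). H_weight w n k * (cmod (c * f n k))\<^sup>2)
      = (\<lambda>z. (cmod c)\<^sup>2 * (case z of (n, k) \<Rightarrow> H_weight w n k * (cmod (f n k))\<^sup>2))"
    by (auto simp: norm_mult power_mult_distrib algebra_simps)
  then show ?thesis using assms by (simp add: H_space_def summable_on_cmult_right)
qed

lemma
  assumes w: "pos_weight w" and f: "f \<in> H_space w" and g: "g \<in> H_space w"
  shows H_space_diff: "(\<lambda>n k. f n k - g n k) \<in> H_space w"
    and hsq_diff_le: "hsq w (\<lambda>n k. f n k - g n k) \<le> 2 * hsq w f + 2 * hsq w g"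
  using H_space_add[OF w f H_space_scale[OF g, of "-1"]]
    hsq_add_le[OF w f H_space_scale[OF g, of "-1"]] hsq_scale[of w "-1" g]
  by simp_all

text \<open>Fatou's lemma in discrete form: each finite partial sum passes to the limit and keeps
  the bound \<open>B\<close>.\<close>

lemma hsq_lower_semicontinuous:
  assumes w: "pos_weight w" and F: "\<And>i. F i \<in> H_space w" and B: "\<And>i. hsq w (F i) \<le> B"
    and lim: "\<And>n k. (\<lambda>i :: nat. F i n k) \<longlonglongrightarrow> G n k"
  shows "G \<in> H_space w" and "hsq w G \<le> B"
proof -
  have fin: "(\<Sum>(n, k)\<in>S. H_weight w n k * (cmod (G n k))\<^sup>2) \<le> B" if "finite S" for S
  proof (rule LIMSEQ_le_const2)
    show "(\<lambda>i. \<Sum>(n, k)\<in>S. H_weight w n k * (cmod (F i n k))\<^sup>2)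
        \<longlonglongrightarrow> (\<Sum>(n, k)\<in>S. H_weight w n k * (cmod (G n k))\<^sup>2)"
      unfolding case_prod_beta by (intro tendsto_intros lim)
    show "\<exists>N. \<forall>i\<ge>N. (\<Sum>(n, k)\<in>S. H_weight w n k * (cmod (F i n k))\<^sup>2) \<le> B"
      using sum_le_hsq[OF w F that] B order_trans by blast
  qed
  show "G \<in> H_space w" "hsq w G \<le> B"
    by (rule H_spaceI[OF w fin]; assumption)+
qed

text \<open>
  The criterion says that \<open>T\<close> maps bounded coordinatewise convergent sequences to norm
  convergent ones.
\<close>

lemma compact_opI:
  assumes v: "pos_weight v" and w: "pos_weight w" and lin: "linear_op v w T"
    and crit: "\<And>\<epsilon>. \<epsilon> > 0 \<Longrightarrow> \<exists>S C. finite S \<and> (\<forall>f\<in>H_space v.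
      hsq w (T f) \<le> \<epsilon> * hsq v f + C * (\<Sum>(n, j)\<in>S. H_weight v n j * (cmod (f n j))\<^sup>2))"
  shows "compact_op v w T"
  unfolding compact_op_def
proof (intro conjI lin allI impI, elim conjE exE)
  fix F :: "nat \<Rightarrow> fseries" and B
  assume F: "\<forall>i. F i \<in> H_space v" and B: "\<forall>i. H_norm v (F i) \<le> B"
  have B': "hsq v (F i) \<le> B\<^sup>2" for i
    using B[rule_format, of i] hsq_nonneg[OF v] unfolding H_norm_hsq
    by (simp add: sqrt_le_D)
  have B0: "B \<ge> 0"
    using B[rule_format, of 0] hsq_nonneg[OF v] unfolding H_norm_hsq
    by (meson order_trans real_sqrt_ge_zero)
  \<comment> \<open>The square root of the weight makes all coordinates bounded by the same
    \<open>B\<close>, whatever the size of the weight.\<close>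
  let ?h = "\<lambda>i z. complex_of_real (sqrt (H_weight v (fst z) (snd z))) * F i (fst z) (snd z)"
  have bd: "norm (?h i z) \<le> B" for i z
  proof (rule power2_le_imp_le[OF _ B0])
    have "(norm (?h i z))\<^sup>2 = H_weight v (fst z) (snd z) * (cmod (F i (fst z) (snd z)))\<^sup>2"
      using H_weight_pos[OF v]
      by (simp add: norm_mult power_mult_distrib less_imp_le real_sqrt_ge_zero)
    also have "\<dots> \<le> B\<^sup>2"
      using term_le_hsq[OF v F[rule_format]] B' order_trans by blast
    finally show "(norm (?h i z))\<^sup>2 \<le> B\<^sup>2" .
  qed
  \<comment> \<open>The coordinates are countably many, so a diagonal argument gives one subsequence
    that converges in all of them.\<close>
  obtain r where r: "strict_mono (r :: nat \<Rightarrow> nat)"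
    and conv: "\<And>z. z \<in> UNIV \<Longrightarrow> \<exists>l. (\<lambda>i. ?h (r i) z) \<longlonglongrightarrow> l"
    using function_convergent_subsequence[of UNIV ?h B] bd by blast
  have "\<exists>l. (\<lambda>i. F (r i) n k) \<longlonglongrightarrow> l" for n k
  proof -
    have nz: "complex_of_real (sqrt (H_weight v n k)) \<noteq> 0"
      using H_weight_pos[OF v, of n k] by simp
    obtain l where "(\<lambda>i. ?h (r i) (n, k)) \<longlonglongrightarrow> l"
      using conv by blast
    from tendsto_divide[OF this tendsto_const nz] show ?thesis
      using nz by auto
  qed
  then obtain G where G: "\<And>n k. (\<lambda>i. F (r i) n k) \<longlonglongrightarrow> G n k"
    by metis
  have GH: "G \<in> H_space v" and GB: "hsq v G \<le> B\<^sup>2"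
    using hsq_lower_semicontinuous[OF v, of "\<lambda>i. F (r i)"] F B' G by blast+
  define d where "d i = (\<lambda>n k. F (r i) n k - G n k)" for i
  have dH: "d i \<in> H_space v" for i
    unfolding d_def using H_space_diff[OF v] F GH by blast
  have dB: "hsq v (d i) \<le> 4 * B\<^sup>2" for i
    using hsq_diff_le[OF v F[rule_format] GH, of "r i"] B'[of "r i"] GB
    unfolding d_def by linarith
  have Td: "T (d i) = (\<lambda>n k. T (F (r i)) n k - T G n k)" for i
  proof -
    have neg: "T (\<lambda>n k. - 1 * G n k) = (\<lambda>n k. - 1 * T G n k)"
      using lin GH unfolding linear_op_def by blast
    have "T (\<lambda>n k. F (r i) n k + - 1 * G n k)
        = (\<lambda>n k. T (F (r i)) n k + T (\<lambda>n k. - 1 * G n k) n k)"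
      using lin F[rule_format, of "r i"] H_space_scale[OF GH, of "-1"]
      unfolding linear_op_def by meson
    then show ?thesis
      unfolding neg by (simp add: d_def)
  qed
  have "(\<lambda>i. hsq w (T (d i))) \<longlonglongrightarrow> 0"
  proof (rule LIMSEQ_I)
    fix e :: real
    assume e: "e > 0"
    \<comment> \<open>\<open>4 * B\<^sup>2\<close> bounds the squared norms of all
      \<open>d i\<close>, so the first term of the criterion costs at most \<open>e / 2\<close>. The
      summand 1 keeps the denominator positive when \<open>B = 0\<close>.\<close>
    define \<epsilon> where "\<epsilon> = e / (2 * (4 * B\<^sup>2 + 1))"
    have \<epsilon>: "\<epsilon> > 0"
      using e by (simp add: \<epsilon>_def add_nonneg_pos)
    obtain S C where S: "finite S" and C: "\<And>f. f \<in> H_space v \<Longrightarrow> hsq w (T f)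
        \<le> \<epsilon> * hsq v f + C * (\<Sum>(n, j)\<in>S. H_weight v n j * (cmod (f n j))\<^sup>2)"
      using crit[OF \<epsilon>] by blast
    have "(\<lambda>i. C * (\<Sum>(n, j)\<in>S. H_weight v n j * (cmod (d i n j))\<^sup>2))
        \<longlonglongrightarrow> C * (\<Sum>(n, j)\<in>S. H_weight v n j * (cmod (G n j - G n j))\<^sup>2)"
      unfolding case_prod_beta d_def by (intro tendsto_intros G)
    then have "(\<lambda>i. C * (\<Sum>(n, j)\<in>S. H_weight v n j * (cmod (d i n j))\<^sup>2)) \<longlonglongrightarrow> 0"
      by (simp add: case_prod_beta)
    then have "eventually (\<lambda>i. C * (\<Sum>(n, j)\<in>S. H_weight v n j * (cmod (d i n j))\<^sup>2) < e / 2) sequentially"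
      using e by (intro order_tendstoD(2)) auto
    then obtain i0 where
      i0: "\<And>i. i \<ge> i0 \<Longrightarrow> C * (\<Sum>(n, j)\<in>S. H_weight v n j * (cmod (d i n j))\<^sup>2) < e / 2"
      unfolding eventually_sequentially by blast
    have "hsq w (T (d i)) < e" if "i \<ge> i0" for i
    proof -
      have "\<epsilon> * hsq v (d i) \<le> \<epsilon> * (4 * B\<^sup>2 + 1)"
        using \<epsilon> dB[of i] by (intro mult_left_mono) auto
      also have "\<dots> = e / 2"
        by (simp add: \<epsilon>_def field_simps add_nonneg_eq_0_iff)
      finally show ?thesis
        using C[OF dH[of i]] i0[OF that] by linarith
    qed
    then show "\<exists>i0. \<forall>i\<ge>i0. norm (hsq w (T (d i)) - 0) < e"
      using hsq_nonneg[OF w] by auto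
  qed
  then have "(\<lambda>i. sqrt (hsq w (T (d i)))) \<longlonglongrightarrow> sqrt 0"
    by (intro tendsto_real_sqrt)
  then have "(\<lambda>i. H_norm w (\<lambda>n k. T (F (r i)) n k - T G n k)) \<longlonglongrightarrow> 0"
    by (simp add: H_norm_hsq Td)
  moreover have "T G \<in> H_space w"
    using lin GH by (simp add: linear_op_def)
  ultimately show "\<exists>g\<in>H_space w. \<exists>r. strict_mono r \<and>
      (\<lambda>i. H_norm w (\<lambda>n k. T (F (r i)) n k - g n k)) \<longlonglongrightarrow> 0"
    using r by blast
qed

subsection \<open>Blockwise Hilbert-Schmidt operators\<close>

text \<open>Block \<open>n\<close> of the result sees only block \<open>n + s\<close> of the
  argument: \<open>s = 1\<close> for the right inverse of \<open>D\<close>, \<open>s = 0\<close> for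
  the projection. On a divergent row \<open>infsum\<close> is 0; the rows converge on
  \<open>H_space\<close> once \<open>kernel_density\<close> is summable.\<close>

definition kernel_op :: "int \<Rightarrow> (int \<Rightarrow> nat \<Rightarrow> nat \<Rightarrow> complex) \<Rightarrow> fseries \<Rightarrow> fseries" where
  "kernel_op s K f = (\<lambda>n k. \<Sum>\<^sub>\<infinity>j. K n k j * f (n + s) j)"

text \<open>Its sum over all \<open>(k, j)\<close> is the squared Hilbert-Schmidt norm of block
  \<open>n\<close> between the two weighted sequence spaces; hence the division by the weight of the
  source.\<close>

definition kernel_density ::
    "(nat \<Rightarrow> real) \<Rightarrow> (nat \<Rightarrow> real) \<Rightarrow> int \<Rightarrow> (int \<Rightarrow> nat \<Rightarrow> nat \<Rightarrow> complex) \<Rightarrow> int \<Rightarrow> nat \<times> nat \<Rightarrow> real" where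
  "kernel_density v w s K n =
     (\<lambda>(k, j). H_weight w n k * (cmod (K n k j))\<^sup>2 / H_weight v (n + s) j)"

text \<open>The second clause says that the Hilbert-Schmidt norms of the blocks tend to zero as
  \<open>|n|\<close> grows, in both directions at once.\<close>

definition vanishing_HS_blocks ::
    "(nat \<Rightarrow> real) \<Rightarrow> (nat \<Rightarrow> real) \<Rightarrow> int \<Rightarrow> (int \<Rightarrow> nat \<Rightarrow> nat \<Rightarrow> complex) \<Rightarrow> bool" where
  "vanishing_HS_blocks v w s K \<longleftrightarrow>
     (\<forall>n. kernel_density v w s K n summable_on UNIV) \<and>
     (\<forall>\<epsilon>>0. finite {n. \<epsilon> < infsum (kernel_density v w s K n) UNIV})"

lemma kernel_density_nonneg:
  assumes "pos_weight v" "pos_weight w"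
  shows "kernel_density v w s K n z \<ge> 0"
  using H_weight_pos[OF assms(1)] H_weight_pos[OF assms(2)]
  by (auto simp: kernel_density_def less_imp_le split: prod.splits)

lemma
  assumes v: "pos_weight v" and w: "pos_weight w"
    and K: "kernel_density v w s K n summable_on UNIV" and f: "f \<in> H_space v"
  shows kernel_row_summable: "(\<lambda>j. K n k j * f (n + s) j) summable_on UNIV"
    and kernel_row_bound: "H_weight w n k * (cmod (kernel_op s K f n k))\<^sup>2
      \<le> (\<Sum>\<^sub>\<infinity>j. kernel_density v w s K n (k, j))
        * (\<Sum>\<^sub>\<infinity>j. H_weight v (n + s) j * (cmod (f (n + s) j))\<^sup>2)"
proof -
  note V = H_weight_pos[OF v] and W = H_weight_pos[OF w]
  have dens: "(\<lambda>j. kernel_density v w s K n (k, j))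
      = (\<lambda>j. H_weight w n k * ((cmod (K n k j))\<^sup>2 / H_weight v (n + s) j))"
    by (simp add: kernel_density_def)
  have c: "(\<lambda>j. (cmod (K n k j))\<^sup>2 / H_weight v (n + s) j) summable_on UNIV"
    using summable_on_fibre[OF K, of k] W[of n k]
    unfolding dens by (subst (asm) summable_on_cmult_right') auto
  have x: "(\<lambda>j. H_weight v (n + s) j * (cmod (f (n + s) j))\<^sup>2) summable_on UNIV"
    using summable_on_fibre[of "\<lambda>(n, k). H_weight v n k * (cmod (f n k))\<^sup>2" "n + s"] f
    by (simp add: H_space_def)
  note CS = weighted_Cauchy_Schwarz[OF V c x]
  show "(\<lambda>j. K n k j * f (n + s) j) summable_on UNIV"
    by (rule CS(1))
  show "H_weight w n k * (cmod (kernel_op s K f n k))\<^sup>2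
      \<le> (\<Sum>\<^sub>\<infinity>j. kernel_density v w s K n (k, j))
        * (\<Sum>\<^sub>\<infinity>j. H_weight v (n + s) j * (cmod (f (n + s) j))\<^sup>2)"
    using mult_left_mono[OF CS(2) less_imp_le[OF W[of n k]]]
    unfolding dens infsum_cmult_right' kernel_op_def by (simp add: mult.assoc)
qed

text \<open>Distinct blocks of the argument go to distinct blocks of the result, so a common bound
  on the Hilbert-Schmidt norms of the blocks bounds the whole operator.\<close>

lemma
  assumes v: "pos_weight v" and w: "pos_weight w"
    and K: "\<And>n. kernel_density v w s K n summable_on UNIV"
    and A: "\<And>n. infsum (kernel_density v w s K n) UNIV \<le> A"
    and f: "f \<in> H_space v"
  shows kernel_op_in_H_space: "kernel_op s K f \<in> H_space w"
    and kernel_op_bound: "hsq w (kernel_op s K f) \<le> A * hsq v f"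
proof -
  define slice where "slice n = (\<Sum>\<^sub>\<infinity>j. H_weight v n j * (cmod (f n j))\<^sup>2)" for n
  have slice0: "slice n \<ge> 0" for n
    unfolding slice_def by (rule infsum_nonneg) (rule H_term_nonneg[OF v])
  have A0: "A \<ge> 0"
    using A[of 0] infsum_nonneg[of UNIV "kernel_density v w s K 0"] kernel_density_nonneg[OF v w]
    by (meson order_trans)
  have fin: "(\<Sum>(n, k)\<in>F. H_weight w n k * (cmod (kernel_op s K f n k))\<^sup>2) \<le> A * hsq v f"
    if "finite F" for F
  proof -
    let ?I = "fst ` F" and ?J = "snd ` F"
    have "(\<Sum>(n, k)\<in>F. H_weight w n k * (cmod (kernel_op s K f n k))\<^sup>2)
        \<le> (\<Sum>(n, k)\<in>?I \<times> ?J. H_weight w n k * (cmod (kernel_op s K f n k))\<^sup>2)"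
      using that subset_fst_snd[of F] by (intro sum_mono2) (auto simp: H_term_nonneg[OF w])
    also have "\<dots> = (\<Sum>n\<in>?I. \<Sum>k\<in>?J. H_weight w n k * (cmod (kernel_op s K f n k))\<^sup>2)"
      by (simp add: sum.cartesian_product)
    also have "\<dots> \<le> (\<Sum>n\<in>?I. \<Sum>k\<in>?J. (\<Sum>\<^sub>\<infinity>j. kernel_density v w s K n (k, j)) * slice (n + s))"
      unfolding slice_def by (intro sum_mono kernel_row_bound[OF v w K f])
    also have "\<dots> \<le> (\<Sum>n\<in>?I. A * slice (n + s))"
    proof (rule sum_mono)
      fix n
      have "(\<Sum>k\<in>?J. \<Sum>\<^sub>\<infinity>j. kernel_density v w s K n (k, j)) \<le> A"
        using sum_fibres_le[OF K kernel_density_nonneg[OF v w], of ?J n] A[of n] that by fastforce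
      then show "(\<Sum>k\<in>?J. (\<Sum>\<^sub>\<infinity>j. kernel_density v w s K n (k, j)) * slice (n + s))
          \<le> A * slice (n + s)"
        unfolding sum_distrib_right[symmetric] by (intro mult_right_mono slice0)
    qed
    \<comment> \<open>Translation by \<open>s\<close> is injective, so each block of
      \<open>f\<close> is counted once.\<close>
    also have "\<dots> = A * (\<Sum>n\<in>(\<lambda>n. n + s) ` ?I. slice n)"
      by (subst sum.reindex) (auto simp: sum_distrib_left inj_on_def)
    also have "\<dots> \<le> A * hsq v f"
      using sum_fibres_le[of "\<lambda>(n, k). H_weight v n k * (cmod (f n k))\<^sup>2" "(\<lambda>n. n + s) ` ?I"]
        f that H_term_nonneg[OF v]
      by (intro mult_left_mono A0) (auto simp: H_space_def hsq_def slice_def)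
    finally show ?thesis .
  qed
  show "kernel_op s K f \<in> H_space w" "hsq w (kernel_op s K f) \<le> A * hsq v f"
    by (rule H_spaceI[OF w fin]; assumption)+
qed

text \<open>Only finitely many blocks exceed 1, so the maximum of 1 and those values is a
  bound.\<close>

lemma vanishing_HS_blocks_bounded:
  assumes "vanishing_HS_blocks v w s K"
  obtains A where "\<And>n. infsum (kernel_density v w s K n) UNIV \<le> A" "A \<ge> 0"
proof -
  let ?a = "\<lambda>n. infsum (kernel_density v w s K n) UNIV"
  have "finite {n. 1 < ?a n}"
    using assms by (simp add: vanishing_HS_blocks_def)
  then have "?a n \<le> Max (insert 1 (?a ` {n. 1 < ?a n}))" for n
    by (cases "1 < ?a n") (auto intro!: Max_ge simp: Max_ge_iff)
  moreover have "Max (insert 1 (?a ` {n. 1 < ?a n})) \<ge> 1"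
    using \<open>finite {n. 1 < ?a n}\<close> by (auto intro!: Max_ge)
  ultimately show ?thesis
    using that by (meson order_trans zero_le_one)
qed

lemma kernel_op_linear:
  assumes v: "pos_weight v" and w: "pos_weight w" and K: "vanishing_HS_blocks v w s K"
  shows "linear_op v w (kernel_op s K)"
proof -
  obtain A where A: "\<And>n. infsum (kernel_density v w s K n) UNIV \<le> A"
    using vanishing_HS_blocks_bounded[OF K] by blast
  have K': "kernel_density v w s K n summable_on UNIV" for n
    using K by (simp add: vanishing_HS_blocks_def)
  note row = kernel_row_summable[OF v w K']
  show ?thesis
    unfolding linear_op_def
  proof (intro conjI ballI allI)
    fix f
    assume f: "f \<in> H_space v"
    show "kernel_op s K f \<in> H_space w"
      by (rule kernel_op_in_H_space[OF v w K' A f])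
    show "kernel_op s K (\<lambda>n k. f n k + g n k) = (\<lambda>n k. kernel_op s K f n k + kernel_op s K g n k)"
      if g: "g \<in> H_space v" for g
      unfolding kernel_op_def
      by (intro ext) (simp add: distrib_left infsum_add[OF row[OF f] row[OF g]])
    show "kernel_op s K (\<lambda>n k. c * f n k) = (\<lambda>n k. c * kernel_op s K f n k)" for c
      unfolding kernel_op_def
      by (intro ext) (simp add: mult.left_commute infsum_cmult_right')
  qed
qed

text \<open>
  Remove from the kernel finitely many entries carrying all but \<open>\<epsilon>\<close> of the Hilbert-Schmidt norm of
  every block.
\<close>

lemma kernel_op_criterion:
  assumes v: "pos_weight v" and w: "pos_weight w" and K: "vanishing_HS_blocks v w s K"
    and e: "\<epsilon> > 0"
  shows "\<exists>S C. finite S \<and> (\<forall>f\<in>H_space v. hsq w (kernel_op s K f)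
    \<le> \<epsilon> * hsq v f + C * (\<Sum>(n, j)\<in>S. H_weight v n j * (cmod (f n j))\<^sup>2))"
proof -
  define d where "d = kernel_density v w s K"
  obtain A where A: "\<And>n. infsum (d n) UNIV \<le> A"
    using vanishing_HS_blocks_bounded[OF K] unfolding d_def by blast
  have d_sum: "d n summable_on UNIV" for n
    using K by (simp add: vanishing_HS_blocks_def d_def)
  have d0: "d n z \<ge> 0" for n z
    unfolding d_def by (rule kernel_density_nonneg[OF v w])
  define Z where "Z = {n. \<epsilon> / 2 < infsum (d n) UNIV}"
  have Z: "finite Z"
    using K half_gt_zero[OF e] unfolding vanishing_HS_blocks_def d_def Z_def by blast
  \<comment> \<open>Outside the finite set \<open>Z\<close> the whole block is already small, so
    nothing has to be kept there. Having \<open>E\<close> empty for these \<open>n\<close> is what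
    makes \<open>S\<close> finite.\<close>
  have "\<exists>E. finite E \<and> (\<forall>F. finite F \<longrightarrow> F \<inter> E = {} \<longrightarrow> sum (d n) F \<le> \<epsilon> / 2)
      \<and> (n \<notin> Z \<longrightarrow> E = {})" for n
  proof (cases "n \<in> Z")
    case True
    obtain E where "finite E" "\<And>F. finite F \<Longrightarrow> F \<inter> E = {} \<Longrightarrow> sum (d n) F \<le> \<epsilon> / 2"
      using summable_on_small_tail[OF d_sum[of n] d0, of "\<epsilon> / 2"] e by auto
    then show ?thesis using True by blast
  next
    case False
    have "sum (d n) F \<le> \<epsilon> / 2" if "finite F" for F
      using finite_sum_le_infsum[OF d_sum[of n] that] d0 False unfolding Z_def by force
    then show ?thesis by blast
  qed
  then obtain E where E: "\<And>n. finite (E n)" 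
    "\<And>n F. finite F \<Longrightarrow> F \<inter> E n = {} \<Longrightarrow> sum (d n) F \<le> \<epsilon> / 2" "\<And>n. n \<notin> Z \<Longrightarrow> E n = {}"
    by metis
  define K1 where "K1 n k j = (if (k, j) \<in> E n then K n k j else 0)" for n k j
  define K2 where "K2 n k j = (if (k, j) \<in> E n then 0 else K n k j)" for n k j
  \<comment> \<open>These are the coordinates of the argument that the finite part \<open>K1\<close>
    reads.\<close>
  define S where "S = (\<lambda>(n, k, j). (n + s, j)) ` Sigma Z E"
  have S: "finite S"
    unfolding S_def using Z E(1) by auto
  have K1d: "kernel_density v w s K1 n z = (if z \<in> E n then d n z else 0)"
    and K2d: "kernel_density v w s K2 n z = (if z \<in> E n then 0 else d n z)" for n z
    by (auto simp: kernel_density_def K1_def K2_def d_def split: prod.splits)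
  have K1f: "sum (kernel_density v w s K1 n) F \<le> A" if "finite F" for n F
  proof -
    have "sum (kernel_density v w s K1 n) F \<le> sum (d n) F"
      by (intro sum_mono) (simp add: K1d d0)
    also have "\<dots> \<le> infsum (d n) UNIV"
      using that d0 by (intro finite_sum_le_infsum[OF d_sum]) auto
    finally show ?thesis using A[of n] by linarith
  qed
  have K2f: "sum (kernel_density v w s K2 n) F \<le> \<epsilon> / 2" if "finite F" for n F
  proof -
    have "sum (kernel_density v w s K2 n) F = sum (d n) (F - E n)"
      using that by (intro sum.mono_neutral_cong_right) (auto simp: K2d)
    then show ?thesis using E(2)[of "F - E n" n] that by auto
  qed
  note K1s = nonneg_summable_on_bounded_sums[OF kernel_density_nonneg[OF v w] K1f]
  note K2s = nonneg_summable_on_bounded_sums[OF kernel_density_nonneg[OF v w] K2f]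
  have "hsq w (kernel_op s K f)
      \<le> \<epsilon> * hsq v f + 2 * A * (\<Sum>(n, j)\<in>S. H_weight v n j * (cmod (f n j))\<^sup>2)"
    if f: "f \<in> H_space v" for f
  proof -
    \<comment> \<open>\<open>K1\<close> does not distinguish \<open>f\<close> from its restriction
      \<open>g\<close> to \<open>S\<close>, so the bound for \<open>K1\<close> involves only the
      coordinates in \<open>S\<close>.\<close>
    define g where "g n j = (if (n, j) \<in> S then f n j else 0)" for n j
    have g_fin: "(\<Sum>(n, j)\<in>F. H_weight v n j * (cmod (g n j))\<^sup>2)
        \<le> (\<Sum>(n, j)\<in>S. H_weight v n j * (cmod (f n j))\<^sup>2)" if "finite F" for F
    proof -
      have "(\<Sum>(n, j)\<in>F. H_weight v n j * (cmod (g n j))\<^sup>2)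
          = (\<Sum>(n, j)\<in>F \<inter> S. H_weight v n j * (cmod (f n j))\<^sup>2)"
        using that by (intro sum.mono_neutral_cong_right) (auto simp: g_def split: if_splits)
      also have "\<dots> \<le> (\<Sum>(n, j)\<in>S. H_weight v n j * (cmod (f n j))\<^sup>2)"
        using S by (intro sum_mono2) (auto simp: H_term_nonneg[OF v])
      finally show ?thesis .
    qed
    note g = H_spaceI[OF v g_fin]
    have "K1 n k j * g (n + s) j = K1 n k j * f (n + s) j" for n k j
    proof (cases "(k, j) \<in> E n")
      case True
      then have "n \<in> Z" using E(3) by blast
      with True have "(n + s, j) \<in> S" by (force simp: S_def)
      then show ?thesis by (simp add: g_def)
    qed (simp add: K1_def)
    then have "kernel_op s K1 f = kernel_op s K1 g"
      unfolding kernel_op_def by (intro ext infsum_cong) (rule sym)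
    moreover have "kernel_op s K f = (\<lambda>n k. kernel_op s K1 f n k + kernel_op s K2 f n k)"
    proof (intro ext)
      fix n k
      have "kernel_op s K f n k = (\<Sum>\<^sub>\<infinity>j. K1 n k j * f (n + s) j + K2 n k j * f (n + s) j)"
        unfolding kernel_op_def by (intro infsum_cong) (simp add: K1_def K2_def)
      then show "kernel_op s K f n k = kernel_op s K1 f n k + kernel_op s K2 f n k"
        unfolding kernel_op_def
        by (simp add: infsum_add[OF kernel_row_summable[OF v w K1s(1) f]
              kernel_row_summable[OF v w K2s(1) f]])
    qed
    ultimately have split:
      "kernel_op s K f = (\<lambda>n k. kernel_op s K1 g n k + kernel_op s K2 f n k)"
      by simp
    have A0: "A \<ge> 0" using K1f[of "{}"] by simp
    have "hsq w (kernel_op s K f) \<le> 2 * hsq w (kernel_op s K1 g) + 2 * hsq w (kernel_op s K2 f)"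
      unfolding split
      using hsq_add_le[OF w kernel_op_in_H_space[OF v w K1s g(1)] kernel_op_in_H_space[OF v w K2s f]] .
    moreover have "hsq w (kernel_op s K1 g) \<le> A * hsq v g"
      by (rule kernel_op_bound[OF v w K1s g(1)])
    moreover have "A * hsq v g \<le> A * (\<Sum>(n, j)\<in>S. H_weight v n j * (cmod (f n j))\<^sup>2)"
      by (rule mult_left_mono[OF g(2) A0])
    moreover have "hsq w (kernel_op s K2 f) \<le> \<epsilon> / 2 * hsq v f"
      by (rule kernel_op_bound[OF v w K2s f])
    ultimately show ?thesis by (simp add: mult.assoc)
  qed
  then show ?thesis using S by blast
qed

lemma kernel_op_compact:
  assumes "pos_weight v" "pos_weight w" "vanishing_HS_blocks v w s K"
  shows "compact_op v w (kernel_op s K)"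
  using assms by (intro compact_opI kernel_op_linear kernel_op_criterion)

text \<open>This is the remainder on the side where the parametrix is an exact inverse.\<close>

lemma zero_compact:
  assumes w: "pos_weight w"
  shows "compact_op w w (\<lambda>f n k. 0)"
proof (rule compact_opI[OF w w])
  have z: "(\<lambda>n k. 0) \<in> H_space w" "hsq w (\<lambda>n k. 0) \<le> 0"
    using H_spaceI[OF w, of "\<lambda>n k. 0" 0] by auto
  then show "linear_op w w (\<lambda>f n k. 0)"
    by (simp add: linear_op_def)
  show "\<exists>S C. finite S \<and> (\<forall>f\<in>H_space w. hsq w (\<lambda>n k. 0)
      \<le> \<epsilon> * hsq w f + C * (\<Sum>(n, j)\<in>S. H_weight w n j * (cmod (f n j))\<^sup>2))" if "\<epsilon> > 0" for \<epsilon>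
    using that z(2) hsq_nonneg[OF w]
    by (intro exI[of _ "{}"] exI[of _ 0]) (auto intro: order_trans[OF z(2)])
qed

text \<open>The estimate of the criterion survives composition with a bounded operator.\<close>

lemma kernel_op_minus_composition_compact:
  assumes u: "pos_weight u" and v: "pos_weight v"
    and K: "vanishing_HS_blocks u v s K" and L: "vanishing_HS_blocks v v t L"
  shows "compact_op u v (\<lambda>f n k. kernel_op s K f n k - kernel_op t L (kernel_op s K f) n k)"
proof (rule compact_opI[OF u v])
  note linK = kernel_op_linear[OF u v K] and linL = kernel_op_linear[OF v v L]
  have KH: "kernel_op s K f \<in> H_space v" if "f \<in> H_space u" for f
    using linK that by (simp add: linear_op_def)
  have LH: "kernel_op t L f \<in> H_space v" if "f \<in> H_space v" for f
    using linL that by (simp add: linear_op_def)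
  show "linear_op u v (\<lambda>f n k. kernel_op s K f n k - kernel_op t L (kernel_op s K f) n k)"
    unfolding linear_op_def
  proof (intro conjI ballI allI)
    fix f
    assume f: "f \<in> H_space u"
    show "(\<lambda>n k. kernel_op s K f n k - kernel_op t L (kernel_op s K f) n k) \<in> H_space v"
      by (rule H_space_diff[OF v KH[OF f] LH[OF KH[OF f]]])
    show "(\<lambda>n k. kernel_op s K (\<lambda>n k. f n k + g n k) n k
          - kernel_op t L (kernel_op s K (\<lambda>n k. f n k + g n k)) n k)
        = (\<lambda>n k. kernel_op s K f n k - kernel_op t L (kernel_op s K f) n k
          + (kernel_op s K g n k - kernel_op t L (kernel_op s K g) n k))"
      if g: "g \<in> H_space u" for g
    proof -
      have "kernel_op s K (\<lambda>n k. f n k + g n k) = (\<lambda>n k. kernel_op s K f n k + kernel_op s K g n k)"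
        using linK f g unfolding linear_op_def by meson
      moreover have "kernel_op t L (\<lambda>n k. kernel_op s K f n k + kernel_op s K g n k)
          = (\<lambda>n k. kernel_op t L (kernel_op s K f) n k + kernel_op t L (kernel_op s K g) n k)"
        using linL KH[OF f] KH[OF g] unfolding linear_op_def by meson
      ultimately show ?thesis by (simp add: algebra_simps)
    qed
    show "(\<lambda>n k. kernel_op s K (\<lambda>n k. c * f n k) n k
          - kernel_op t L (kernel_op s K (\<lambda>n k. c * f n k)) n k)
        = (\<lambda>n k. c * (kernel_op s K f n k - kernel_op t L (kernel_op s K f) n k))" for c
    proof -
      have "kernel_op s K (\<lambda>n k. c * f n k) = (\<lambda>n k. c * kernel_op s K f n k)"
        using linK f unfolding linear_op_def by meson
      moreover have "kernel_op t L (\<lambda>n k. c * kernel_op s K f n k)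
          = (\<lambda>n k. c * kernel_op t L (kernel_op s K f) n k)"
        using linL KH[OF f] unfolding linear_op_def by meson
      ultimately show ?thesis by (simp add: algebra_simps)
    qed
  qed
  fix \<epsilon> :: real
  assume e: "\<epsilon> > 0"
  obtain A where A: "\<And>n. infsum (kernel_density v v t L n) UNIV \<le> A" and A0: "A \<ge> 0"
    using vanishing_HS_blocks_bounded[OF L] by blast
  have Ls: "kernel_density v v t L n summable_on UNIV" for n
    using L by (simp add: vanishing_HS_blocks_def)
  \<comment> \<open>\<open>2 + 2 * A\<close> is the constant in
    \<open>2|x|\<^sup>2 + 2|Lx|\<^sup>2 \<le> (2 + 2A)|x|\<^sup>2\<close>, where \<open>A\<close>
    bounds the squared norm of the second operator.\<close>
  obtain S C where S: "finite S" and C: "\<And>f. f \<in> H_space u \<Longrightarrow> hsq v (kernel_op s K f)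
      \<le> \<epsilon> / (2 + 2 * A) * hsq u f + C * (\<Sum>(n, j)\<in>S. H_weight u n j * (cmod (f n j))\<^sup>2)"
    using kernel_op_criterion[OF u v K, of "\<epsilon> / (2 + 2 * A)"] e A0 by auto
  have "hsq v (\<lambda>n k. kernel_op s K f n k - kernel_op t L (kernel_op s K f) n k)
      \<le> \<epsilon> * hsq u f + (2 + 2 * A) * C * (\<Sum>(n, j)\<in>S. H_weight u n j * (cmod (f n j))\<^sup>2)"
    if f: "f \<in> H_space u" for f
  proof -
    have "hsq v (\<lambda>n k. kernel_op s K f n k - kernel_op t L (kernel_op s K f) n k)
        \<le> 2 * hsq v (kernel_op s K f) + 2 * hsq v (kernel_op t L (kernel_op s K f))"
      by (rule hsq_diff_le[OF v KH[OF f] LH[OF KH[OF f]]])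
    also have "\<dots> \<le> (2 + 2 * A) * hsq v (kernel_op s K f)"
      using kernel_op_bound[OF v v Ls A KH[OF f]] by (simp add: algebra_simps)
    also have "\<dots> \<le> (2 + 2 * A) * (\<epsilon> / (2 + 2 * A) * hsq u f
        + C * (\<Sum>(n, j)\<in>S. H_weight u n j * (cmod (f n j))\<^sup>2))"
      using A0 by (intro mult_left_mono C f) auto
    also have "\<dots> = \<epsilon> * hsq u f + (2 + 2 * A) * C * (\<Sum>(n, j)\<in>S. H_weight u n j * (cmod (f n j))\<^sup>2)"
      using A0 by (simp add: distrib_left add_nonneg_eq_0_iff)
    finally show ?thesis .
  qed
  then show "\<exists>S C. finite S \<and> (\<forall>f\<in>H_space u.
      hsq v (\<lambda>n k. kernel_op s K f n k - kernel_op t L (kernel_op s K f) n k)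
      \<le> \<epsilon> * hsq u f + C * (\<Sum>(n, j)\<in>S. H_weight u n j * (cmod (f n j))\<^sup>2))"
    using S by blast
qed

subsection \<open>The right inverse and the projection onto the kernel\<close>

text \<open>From some \<open>K\<close> on the increments differ from \<open>b\<close> by at most
  \<open>|b| / 2\<close>, so \<open>\<beta> (K + i)\<close> stays within \<open>i |b| / 2\<close> of
  \<open>\<beta> K + i b\<close>. The finitely many smaller indices are covered by
  \<open>nz\<close>. The upper bound holds because convergent increments are bounded.\<close>

lemma linear_growth:
  fixes \<beta> :: "nat \<Rightarrow> complex"
  assumes lim: "(\<lambda>k. \<beta> (k + 1) - \<beta> k) \<longlonglongrightarrow> b" and b: "b \<noteq> 0" and nz: "\<And>k. \<beta> k \<noteq> 0"
  shows "\<exists>c>0. \<forall>k. c * (real k + 1) \<le> cmod (\<beta> k)"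
    and "\<exists>C. \<forall>k. cmod (\<beta> k) \<le> C * (real k + 1)"
proof -
  have b0: "cmod b > 0" using b by simp
  obtain K where K: "\<And>k. k \<ge> K \<Longrightarrow> cmod (\<beta> (k + 1) - \<beta> k - b) \<le> cmod b / 2"
    using LIMSEQ_D[OF lim half_gt_zero[OF b0]] less_imp_le by metis
  have dev: "cmod (\<beta> (K + i) - \<beta> K - of_nat i * b) \<le> cmod b / 2 * real i" for i
  proof (induction i)
    case (Suc i)
    have "\<beta> (K + Suc i) - \<beta> K - of_nat (Suc i) * b
        = (\<beta> (K + i) - \<beta> K - of_nat i * b) + (\<beta> (K + i + 1) - \<beta> (K + i) - b)"
      by (simp add: algebra_simps)
    also have "cmod \<dots> \<le> cmod b / 2 * real i + cmod b / 2"
      by (intro norm_triangle_mono Suc.IH K) simp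
    finally show ?case by (simp add: algebra_simps)
  qed simp
  have low: "cmod b / 2 * (real k - real K) - cmod (\<beta> K) \<le> cmod (\<beta> k)" if k: "k \<ge> K" for k
  proof -
    define i where "i = k - K"
    have ki: "k = K + i" using k by (simp add: i_def)
    have "of_nat i * b = \<beta> k - \<beta> K - (\<beta> k - \<beta> K - of_nat i * b)"
      by simp
    then have "cmod (of_nat i * b) \<le> cmod (\<beta> k) + cmod (\<beta> K) + cmod (\<beta> k - \<beta> K - of_nat i * b)"
      by (metis norm_triangle_ineq4 add_right_mono order_trans)
    then have "real i * cmod b \<le> cmod (\<beta> k) + cmod (\<beta> K) + cmod b / 2 * real i"
      using dev[of i] by (simp add: norm_mult ki)
    then show ?thesis by (simp add: ki algebra_simps)
  qed
  \<comment> \<open>From here on the losses from \<open>K\<close> and \<open>\<beta> K\<close> in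
    \<open>low\<close> cost no more than half of the slope \<open>cmod b / 2\<close>.\<close>
  define K1 where "K1 = max K (nat \<lceil>1 + 2 * real K + 4 * cmod (\<beta> K) / cmod b\<rceil>)"
  have large: "cmod b / 4 * (real k + 1) \<le> cmod (\<beta> k)" if "k \<ge> K1" for k
  proof -
    have "k \<ge> K" "1 + 2 * real K + 4 * cmod (\<beta> K) / cmod b \<le> real k"
      using that unfolding K1_def by linarith+
    then have "cmod b / 4 * (1 + 2 * real K + 4 * cmod (\<beta> K) / cmod b) \<le> cmod b / 4 * real k"
      using b0 by (intro mult_left_mono) auto
    then have "cmod b / 4 * (1 + 2 * real K) + cmod (\<beta> K) \<le> cmod b / 4 * real k"
      using b0 by (simp add: distrib_left)
    then show ?thesis
      using low[OF \<open>k \<ge> K\<close>] by (simp add: algebra_simps)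
  qed
  define c where "c = Min (insert (cmod b / 4) ((\<lambda>k. cmod (\<beta> k) / (real k + 1)) ` {..<K1}))"
  have "c > 0"
    unfolding c_def using b0 nz by (subst Min_gr_iff) auto
  moreover have "c * (real k + 1) \<le> cmod (\<beta> k)" for k
  proof (cases "k < K1")
    case True
    then have "c \<le> cmod (\<beta> k) / (real k + 1)"
      unfolding c_def by (intro Min_le) auto
    then show ?thesis by (simp add: pos_le_divide_eq)
  next
    case False
    have "c \<le> cmod b / 4"
      unfolding c_def by (intro Min_le) auto
    then have "c * (real k + 1) \<le> cmod b / 4 * (real k + 1)"
      by (intro mult_right_mono) auto
    then show ?thesis using large[of k] False by linarith
  qed
  ultimately show "\<exists>c>0. \<forall>k. c * (real k + 1) \<le> cmod (\<beta> k)" by blast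
  obtain D where D: "D > 0" "\<And>k. cmod (\<beta> (k + 1) - \<beta> k) \<le> D"
    using convergent_imp_Bseq[OF convergentI[OF lim]] unfolding Bseq_def by auto
  have "cmod (\<beta> k) \<le> (cmod (\<beta> 0) + D) * (real k + 1)" for k
  proof (induction k)
    case (Suc k)
    have "cmod (\<beta> (Suc k)) \<le> cmod (\<beta> k) + cmod (\<beta> (k + 1) - \<beta> k)"
      using norm_triangle_ineq[of "\<beta> k" "\<beta> (k + 1) - \<beta> k"] by simp
    also have "\<dots> \<le> (cmod (\<beta> 0) + D) * (real k + 1) + (cmod (\<beta> 0) + D)"
      using Suc.IH D(2)[of k] norm_ge_zero[of "\<beta> 0"] by linarith
    finally show ?case by (simp add: algebra_simps)
  qed (use D in auto)
  then show "\<exists>C. \<forall>k. cmod (\<beta> k) \<le> C * (real k + 1)" by blast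
qed

lemma D_op_diff:
  "D_op \<alpha> \<beta> (\<lambda>n k. f n k - g n k) = (\<lambda>n k. D_op \<alpha> \<beta> f n k - D_op \<alpha> \<beta> g n k)"
  by (intro ext)
    (simp add: D_op_def diag_left_def diag_right_def shift_left_def shift_right_def algebra_simps)

text \<open>The quotient bounded in (v), with \<open>k + d\<close> for \<open>j\<close> and
  \<open>l\<close> for the number of factors; \<open>l = 0\<close> is allowed.\<close>

definition shift_ratio :: "(nat \<Rightarrow> complex) \<Rightarrow> nat \<Rightarrow> nat \<Rightarrow> nat \<Rightarrow> complex" where
  "shift_ratio \<beta> d k l = (\<Prod>i<l. \<beta> (k + i)) / (\<Prod>i<l. \<beta> (k + d + i))"

lemma shift_ratio_0 [simp]: "shift_ratio \<beta> d k 0 = 1"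
  by (simp add: shift_ratio_def)

lemma shift_ratio_Suc:
  "shift_ratio \<beta> d k (Suc l) = shift_ratio \<beta> d k l * (\<beta> (k + l) / \<beta> (k + d + l))"
  by (simp add: shift_ratio_def)

lemma shift_ratio_Suc_front:
  "shift_ratio \<beta> d k (Suc l) = \<beta> k / \<beta> (k + d) * shift_ratio \<beta> d (Suc k) l"
  unfolding shift_ratio_def prod.lessThan_Suc_shift by simp

text \<open>
  Row \<open>k\<close>, column \<open>j\<close> of the solution of \<open>Df = g\<close>, expressing \<open>f\<^sub>n(k)\<close> by \<open>g\<^sub>n\<^sub>+\<^sub>1(j)\<close>. For \<open>n \<ge> 0\<close> the
  recursion is solved backwards from infinity, for \<open>n < 0\<close> forwards from \<open>k = 0\<close>.
\<close>

definition inverse_kernel ::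
    "(nat \<Rightarrow> complex) \<Rightarrow> (nat \<Rightarrow> complex) \<Rightarrow> int \<Rightarrow> nat \<Rightarrow> nat \<Rightarrow> complex" where
  "inverse_kernel \<beta> \<mu> n k j =
    (if n \<ge> 0 then
       if k \<le> j then shift_ratio \<beta> (nat n) k (j - k) / \<beta> (j + nat n) * (\<mu> j / \<mu> k) else 0
     else let d = nat (- n) - 1 in
       if j \<le> k then - (shift_ratio \<beta> d j (k - j) / \<beta> (k + d) * (\<mu> (j + d) / \<mu> (k + d + 1))) else 0)"

text \<open>
  The solution of \<open>Df = 0\<close> in the block \<open>n \<ge> 0\<close> with value \<open>1\<close> at \<open>0\<close>; its norm is finite only for
  \<open>n < N\<close>, so \<open>kernel_vector_sq\<close> is junk for other \<open>n\<close>.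
\<close>

definition kernel_vector :: "(nat \<Rightarrow> complex) \<Rightarrow> (nat \<Rightarrow> complex) \<Rightarrow> int \<Rightarrow> nat \<Rightarrow> complex" where
  "kernel_vector \<alpha> \<beta> n k = (\<Prod>i<k. \<beta> (i + nat n) / \<alpha> i)"

definition kernel_vector_sq ::
    "(nat \<Rightarrow> real) \<Rightarrow> (nat \<Rightarrow> complex) \<Rightarrow> (nat \<Rightarrow> complex) \<Rightarrow> int \<Rightarrow> real" where
  "kernel_vector_sq w \<alpha> \<beta> n = (\<Sum>\<^sub>\<infinity>j. w j * (cmod (kernel_vector \<alpha> \<beta> n j))\<^sup>2)"

text \<open>With \<open>v\<close> the kernel vector of the block, this is the weighted orthogonal
  projection onto its span, \<open>f \<mapsto> v <f, v> / |v|\<^sup>2\<close>. The range of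
  \<open>n\<close> is cut at \<open>N\<close> because beyond it \<open>v\<close> has infinite
  norm.\<close>

definition projection_kernel ::
    "(nat \<Rightarrow> real) \<Rightarrow> (nat \<Rightarrow> complex) \<Rightarrow> (nat \<Rightarrow> complex) \<Rightarrow> nat \<Rightarrow> int \<Rightarrow> nat \<Rightarrow> nat \<Rightarrow> complex" where
  "projection_kernel w \<alpha> \<beta> N n k j =
    (if 0 \<le> n \<and> n < int N
     then kernel_vector \<alpha> \<beta> n k * cnj (kernel_vector \<alpha> \<beta> n j) * of_real (w j / kernel_vector_sq w \<alpha> \<beta> n)
     else 0)"

text \<open>The hypotheses in the form used by the estimates: \<open>c\<close> and \<open>B\<close>
  come from (i), \<open>M\<close> bounds the quotients of (v) including the empty one, and
  \<open>kernel_dim\<close> is (vii).\<close>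

locale parametrix_data =
  fixes w w' :: "nat \<Rightarrow> real" and \<alpha> \<beta> \<mu> :: "nat \<Rightarrow> complex" and c B M :: real and N :: nat
  assumes w: "pos_weight w" and w': "pos_weight w'"
    and c: "c > 0" and \<beta>_lower: "\<And>k. c * (real k + 1) \<le> cmod (\<beta> k)"
    and \<beta>_upper: "\<And>k. cmod (\<beta> k) \<le> B * (real k + 1)"
    and \<mu>_nz: "\<And>k. \<mu> k \<noteq> 0" and \<mu>_0: "\<mu> 0 = 1"
    and \<alpha>_eq: "\<And>k. \<alpha> k = \<beta> k * (\<mu> (k + 1) / \<mu> k)"
    and ratio_le: "\<And>d k l. cmod (shift_ratio \<beta> d k l) \<le> M"
    and HS: "(\<lambda>(k, j). 1 / (real (max j k) + 1)\<^sup>2 * (cmod (\<mu> j / \<mu> k))\<^sup>2 * (w k / w' j))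
      summable_on UNIV"
    and kernel_dim: "\<And>n. summable (\<lambda>k. (1 + real k) ^ (2 * n) / (cmod (\<mu> k))\<^sup>2 * w k) \<longleftrightarrow> n < N"
begin

lemma \<beta>_nz: "\<beta> k \<noteq> 0"
proof
  assume "\<beta> k = 0"
  then show False using \<beta>_lower[of k] mult_pos_pos[OF c, of "real k + 1"] by simp
qed

lemma \<alpha>_nz: "\<alpha> k \<noteq> 0"
  by (simp add: \<alpha>_eq \<beta>_nz \<mu>_nz)

lemma M_ge_1: "M \<ge> 1"
  using ratio_le[of 0 0 0] by simp

section \<open>Hilbert-Schmidt estimates for the right inverse\<close>

definition HS_term :: "nat \<times> nat \<Rightarrow> real" where
  "HS_term = (\<lambda>(k, j). 1 / (real (max j k) + 1)\<^sup>2 * (cmod (\<mu> j / \<mu> k))\<^sup>2 * (w k / w' j))"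

lemma HS_term_summable: "HS_term summable_on UNIV"
  using HS by (simp add: HS_term_def)

lemma HS_term_nonneg: "HS_term z \<ge> 0"
  using w w' by (auto simp: HS_term_def pos_weight_def less_imp_le split: prod.splits)

text \<open>For \<open>k \<le> j\<close> the denominator \<open>\<beta> (j + n)\<close> is at least
  \<open>c (j + n + 1)\<close>, whereas (vi) provides only \<open>j + 1\<close>. The quotient of the
  two is kept as a factor: at each fixed entry it tends to zero as \<open>n\<close> grows.\<close>

lemma density_nonneg_index:
  assumes "n \<ge> 0"
  shows "kernel_density w' w 1 (inverse_kernel \<beta> \<mu>) n (k, j)
    \<le> (M / c)\<^sup>2 * (((real (max j k) + 1) / (real (max j k) + 1 + real_of_int n))\<^sup>2 * HS_term (k, j))"
proof (cases "k \<le> j")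
  case True
  define m where "m = nat n"
  have n: "n = int m" using assms by (simp add: m_def)
  define J where "J = real j + real m + 1"
  have J: "J > 0" by (simp add: J_def)
  have \<beta>j: "c * J \<le> cmod (\<beta> (j + m))"
    using \<beta>_lower[of "j + m"] by (simp add: J_def add.assoc)
  have "cmod (inverse_kernel \<beta> \<mu> n k j)
      = cmod (shift_ratio \<beta> m k (j - k)) / cmod (\<beta> (j + m)) * cmod (\<mu> j / \<mu> k)"
    using True assms by (simp add: inverse_kernel_def norm_mult norm_divide m_def)
  also have "\<dots> \<le> M / (c * J) * cmod (\<mu> j / \<mu> k)"
    using ratio_le M_ge_1 c J \<beta>j by (intro mult_right_mono frac_le) auto
  finally have "(cmod (inverse_kernel \<beta> \<mu> n k j))\<^sup>2 \<le> (M / (c * J) * cmod (\<mu> j / \<mu> k))\<^sup>2"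
    by (intro power_mono) auto
  then have "w k * (cmod (inverse_kernel \<beta> \<mu> n k j))\<^sup>2 / w' j
      \<le> w k * (M / (c * J) * cmod (\<mu> j / \<mu> k))\<^sup>2 / w' j"
    using w w' by (intro divide_right_mono mult_left_mono) (auto simp: pos_weight_def less_imp_le)
  also have "\<dots> = (M / c)\<^sup>2 * (((real j + 1) / J)\<^sup>2
      * (1 / (real j + 1)\<^sup>2 * (cmod (\<mu> j / \<mu> k))\<^sup>2 * (w k / w' j)))"
    by (simp add: power_mult_distrib power_divide mult_ac)
  finally show ?thesis
    using True assms by (simp add: kernel_density_def H_weight_def HS_term_def J_def n max_def algebra_simps)
next
  case False
  then show ?thesis
    using assms HS_term_nonneg by (simp add: kernel_density_def inverse_kernel_def)
qed

lemma density_nonneg_index':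
  assumes "n \<ge> 0"
  shows "kernel_density w' w 1 (inverse_kernel \<beta> \<mu>) n z \<le> (M / c)\<^sup>2 * HS_term z"
proof -
  obtain k j where z: "z = (k, j)" by fastforce
  have "((real (max j k) + 1) / (real (max j k) + 1 + real_of_int n))\<^sup>2 * HS_term (k, j) \<le> 1 * HS_term (k, j)"
    using assms by (intro mult_right_mono power_le_one HS_term_nonneg) auto
  then show ?thesis
    using density_nonneg_index[OF assms, of k j] mult_left_mono[of _ _ "(M / c)\<^sup>2"] z
    by (smt (verit) mult_1 zero_le_power2)
qed

text \<open>Here the weights and \<open>\<mu>\<close> are read at the translated place
  \<open>(k + d + 1, j + d)\<close>, so the block is dominated by a part of the sum in (vi) that
  moves off to infinity with \<open>d\<close>.\<close>

lemma density_neg_index: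
  "kernel_density w' w 1 (inverse_kernel \<beta> \<mu>) (- int (Suc d)) (k, j)
    \<le> 4 * (M / c)\<^sup>2 * HS_term (k + Suc d, j + d)"
proof (cases "j \<le> k")
  case True
  define J where "J = real k + real d + 1"
  have J: "J \<ge> 1" by (simp add: J_def)
  have \<beta>k: "c * J \<le> cmod (\<beta> (k + d))"
    using \<beta>_lower[of "k + d"] by (simp add: J_def add.assoc)
  have d: "nat (1 + int d) = Suc d" "nat (int d + 1) = Suc d" by auto
  have weights: "H_weight w (- int (Suc d)) k = w (k + Suc d)"
    "H_weight w' (- int (Suc d) + 1) j = w' (j + d)"
    by (auto simp: H_weight_def d)
  have "cmod (inverse_kernel \<beta> \<mu> (- int (Suc d)) k j)
      = cmod (shift_ratio \<beta> d j (k - j)) / cmod (\<beta> (k + d)) * cmod (\<mu> (j + d) / \<mu> (k + Suc d))"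
    using True by (simp add: inverse_kernel_def norm_mult norm_divide d)
  also have "\<dots> \<le> M / (c * J) * cmod (\<mu> (j + d) / \<mu> (k + Suc d))"
    using ratio_le M_ge_1 c J \<beta>k by (intro mult_right_mono frac_le) auto
  \<comment> \<open>\<open>\<beta> (k + d)\<close> gives \<open>J = k + d + 1\<close>, but the term
    of (vi) has \<open>k + d + 2\<close> in this place. Since \<open>J \<ge> 1\<close>,
    \<open>J + 1 \<le> 2 * J\<close>; squaring this 2 gives the 4 of the statement.\<close>
  also have "M / (c * J) = 2 * M / (c * (2 * J))"
    by simp
  also have "\<dots> * cmod (\<mu> (j + d) / \<mu> (k + Suc d))
      \<le> 2 * M / (c * (J + 1)) * cmod (\<mu> (j + d) / \<mu> (k + Suc d))"
    using M_ge_1 c J by (intro mult_right_mono divide_left_mono mult_left_mono mult_pos_pos) auto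
  finally have "(cmod (inverse_kernel \<beta> \<mu> (- int (Suc d)) k j))\<^sup>2
      \<le> (2 * M / (c * (J + 1)) * cmod (\<mu> (j + d) / \<mu> (k + Suc d)))\<^sup>2"
    by (intro power_mono) auto
  then have "w (k + Suc d) * (cmod (inverse_kernel \<beta> \<mu> (- int (Suc d)) k j))\<^sup>2 / w' (j + d)
      \<le> w (k + Suc d) * (2 * M / (c * (J + 1)) * cmod (\<mu> (j + d) / \<mu> (k + Suc d)))\<^sup>2 / w' (j + d)"
    using w w' by (intro divide_right_mono mult_left_mono) (auto simp: pos_weight_def less_imp_le)
  also have "\<dots> = 4 * (M / c)\<^sup>2 * (1 / (J + 1)\<^sup>2 * (cmod (\<mu> (j + d) / \<mu> (k + Suc d)))\<^sup>2
      * (w (k + Suc d) / w' (j + d)))"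
    by (simp add: power_mult_distrib power_divide mult_ac)
  also have "J + 1 = real (max (j + d) (k + Suc d)) + 1"
    using True by (simp add: J_def max_def)
  finally show ?thesis
    unfolding kernel_density_def split weights HS_term_def .
next
  case False
  then show ?thesis
    using HS_term_nonneg by (simp add: kernel_density_def inverse_kernel_def)
qed

lemma density_summable: "kernel_density w' w 1 (inverse_kernel \<beta> \<mu>) n summable_on UNIV"
proof (cases "n \<ge> 0")
  case True
  show ?thesis
    using density_nonneg_index'[OF True] kernel_density_nonneg[OF w' w]
    by (intro summable_on_comparison_test[OF summable_on_cmult_right[OF HS_term_summable]]) auto
next
  case False
  define d where "d = nat (- n) - 1"
  have n: "n = - int (Suc d)" using False by (simp add: d_def)
  let ?h = "\<lambda>(k, j). (k + Suc d, j + d)"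
  have "inj ?h" by (auto simp: inj_on_def)
  then have "(HS_term \<circ> ?h) summable_on UNIV"
    using summable_on_subset_banach[OF HS_term_summable, of "range ?h"] by (simp add: summable_on_reindex)
  then have "(\<lambda>z. 4 * (M / c)\<^sup>2 * (HS_term \<circ> ?h) z) summable_on UNIV"
    by (rule summable_on_cmult_right)
  moreover have "kernel_density w' w 1 (inverse_kernel \<beta> \<mu>) n z \<le> 4 * (M / c)\<^sup>2 * (HS_term \<circ> ?h) z" for z
    using density_neg_index[of d "fst z" "snd z"] unfolding n by (simp only: o_def split_beta prod.collapse)
  ultimately show ?thesis
    using kernel_density_nonneg[OF w' w] by (rule summable_on_comparison_test)
qed

text \<open>The decay has two causes. For \<open>n\<close> towards minus infinity the translated
  entries leave any finite set \<open>E\<close> that carries all but \<open>\<delta>\<close> of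
  (vi). For \<open>n\<close> towards infinity the entries off \<open>E\<close> contribute little
  uniformly in \<open>n\<close>, and the finitely many entries in \<open>E\<close> are damped by the
  factor from \<open>density_nonneg_index\<close>.\<close>

lemma inverse_kernel_HS: "vanishing_HS_blocks w' w 1 (inverse_kernel \<beta> \<mu>)"
  unfolding vanishing_HS_blocks_def
proof (intro conjI allI impI density_summable)
  fix \<epsilon> :: real
  assume e: "\<epsilon> > 0"
  let ?D = "(M / c)\<^sup>2" and ?k = "kernel_density w' w 1 (inverse_kernel \<beta> \<mu>)"
  have D: "?D > 0" using M_ge_1 c by simp
  \<comment> \<open>The 4 is the constant of \<open>density_neg_index\<close>; for
    \<open>n \<ge> 0\<close> only \<open>2 * \<delta>\<close> is spent.\<close>
  define \<delta> where "\<delta> = \<epsilon> / (4 * ?D)"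
  have \<delta>: "\<delta> > 0" using e D by (simp add: \<delta>_def)
  have D\<delta>: "?D * \<delta> = \<epsilon> / 4" using M_ge_1 c by (simp add: \<delta>_def)
  obtain E where E: "finite E" "\<And>F. finite F \<Longrightarrow> F \<inter> E = {} \<Longrightarrow> sum HS_term F \<le> \<delta>"
    using summable_on_small_tail[OF HS_term_summable HS_term_nonneg \<delta>] by blast
  have neg: "infsum (?k (- int (Suc d))) UNIV \<le> \<epsilon>" if d: "d \<ge> Max (insert 0 (fst ` E))" for d
  proof (rule infsum_le_finite_sums[OF density_summable])
    fix F :: "(nat \<times> nat) set"
    assume F: "finite F"
    let ?h = "\<lambda>(k, j). (k + Suc d, j + d)"
    have h: "inj_on ?h F" by (auto simp: inj_on_def)
    have "sum (?k (- int (Suc d))) F \<le> (\<Sum>z\<in>F. 4 * ?D * HS_term (?h z))"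
      using density_neg_index[of d] by (intro sum_mono) (auto simp: split_beta)
    also have "\<dots> = 4 * ?D * sum HS_term (?h ` F)"
      by (subst sum.reindex[OF h]) (simp add: sum_distrib_left)
    also have "\<dots> \<le> 4 * ?D * \<delta>"
    proof (intro mult_left_mono E(2))
      have "k \<le> d" if "(k, j) \<in> E" for k j
      proof -
        have "k \<le> Max (insert 0 (fst ` E))"
          using that E(1) by (intro Max_ge) (auto intro!: image_eqI[of _ _ "(k, j)"])
        then show ?thesis using d by linarith
      qed
      then show "?h ` F \<inter> E = {}" by fastforce
    qed (use F D in auto)
    finally show "sum (?k (- int (Suc d))) F \<le> \<epsilon>" using D\<delta> by simp
  qed
  define \<theta> where
    "\<theta> n z = ((real (max (snd z) (fst z)) + 1) / (real (max (snd z) (fst z)) + 1 + real n))\<^sup>2 * HS_term z"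
    for n z
  have "(\<lambda>n. \<theta> n z) \<longlonglongrightarrow> 0" for z
  proof -
    have "(\<lambda>n. (r + 1) / (r + 1 + real n)) \<longlonglongrightarrow> 0" for r
      by (rule tendsto_divide_0[OF tendsto_const filterlim_at_top_imp_at_infinity[OF
            filterlim_tendsto_add_at_top[OF tendsto_const filterlim_real_sequentially]]])
    from tendsto_mult[OF tendsto_power[OF this, of _ 2] tendsto_const[of "HS_term z"]] show ?thesis
      unfolding \<theta>_def by simp
  qed
  then have "(\<lambda>n. \<Sum>z\<in>E. \<theta> n z) \<longlonglongrightarrow> (\<Sum>z\<in>E. 0)"
    by (intro tendsto_sum)
  then have "eventually (\<lambda>n. (\<Sum>z\<in>E. \<theta> n z) < \<delta>) sequentially"
    using \<delta> by (intro order_tendstoD(2)) auto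
  then obtain n0 where n0: "\<And>n. n \<ge> n0 \<Longrightarrow> (\<Sum>z\<in>E. \<theta> n z) < \<delta>"
    unfolding eventually_sequentially by blast
  have pos: "infsum (?k (int n)) UNIV \<le> \<epsilon>" if n: "n \<ge> n0" for n
  proof (rule infsum_le_finite_sums[OF density_summable])
    fix F :: "(nat \<times> nat) set"
    assume F: "finite F"
    have "sum (?k (int n)) F = sum (?k (int n)) (F - E) + sum (?k (int n)) (F \<inter> E)"
      using F by (subst sum.union_disjoint[symmetric]) (auto intro!: arg_cong[of _ _ "sum _"])
    also have "\<dots> \<le> (\<Sum>z\<in>F - E. ?D * HS_term z) + (\<Sum>z\<in>F \<inter> E. ?D * \<theta> n z)"
    proof (intro add_mono sum_mono)
      show "?k (int n) z \<le> ?D * HS_term z" for z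
        by (rule density_nonneg_index') simp
      show "?k (int n) z \<le> ?D * \<theta> n z" for z
        using density_nonneg_index[of "int n" "fst z" "snd z"] by (simp add: \<theta>_def)
    qed
    also have "\<dots> = ?D * (sum HS_term (F - E) + sum (\<theta> n) (F \<inter> E))"
      by (simp add: sum_distrib_left distrib_left)
    also have "\<dots> \<le> ?D * (\<delta> + \<delta>)"
    proof (intro mult_left_mono add_mono E(2))
      have "sum (\<theta> n) (F \<inter> E) \<le> sum (\<theta> n) E"
        using E(1) by (intro sum_mono2) (auto simp: \<theta>_def HS_term_nonneg)
      then show "sum (\<theta> n) (F \<inter> E) \<le> \<delta>" using n0[OF n] by linarith
    qed (use F in auto)
    finally show "sum (?k (int n)) F \<le> \<epsilon>" using D\<delta> e by (simp add: distrib_left)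
  qed
  have "{n. \<epsilon> < infsum (?k n) UNIV} \<subseteq> {- int (Suc (Max (insert 0 (fst ` E)))) .. int n0}"
  proof (intro subsetI, clarsimp)
    fix n :: int
    assume n: "\<epsilon> < infsum (?k n) UNIV"
    show "- 1 - int (Max (insert 0 (fst ` E))) \<le> n \<and> n \<le> int n0"
    proof (cases "n \<ge> 0")
      case True
      then show ?thesis using n pos[of "nat n"] by (cases "n0 \<le> nat n") auto
    next
      case False
      then have "n = - int (Suc (nat (- n) - 1))" by simp
      then show ?thesis
        using n neg[of "nat (- n) - 1"] False
        by (cases "Max (insert 0 (fst ` E)) \<le> nat (- n) - 1") (auto simp del: Max_insert)
    qed
  qed
  then show "finite {n. \<epsilon> < infsum (?k n) UNIV}"
    using finite_subset by blast
qed

section \<open>The identity \<open>DQ\<^sub>0 = I\<close>\<close>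

text \<open>The kernel is a Green's function of the recursion: above the diagonal the two terms
  cancel by \<open>shift_ratio_Suc_front\<close>, on it only the first is present, and below it both
  vanish.\<close>

lemma inverse_kernel_step_nonneg:
  assumes "n \<ge> 0"
  shows "\<beta> (k + nat n) * inverse_kernel \<beta> \<mu> n k j - \<alpha> k * inverse_kernel \<beta> \<mu> n (k + 1) j
    = (if j = k then 1 else 0)"
proof (cases "k < j")
  case True
  then have jk: "j - k = Suc (j - Suc k)" by simp
  show ?thesis
    using True assms \<beta>_nz[of k] \<beta>_nz[of "k + nat n"] \<mu>_nz[of k] \<mu>_nz[of "Suc k"]
    unfolding inverse_kernel_def jk shift_ratio_Suc_front \<alpha>_eq by simp
next
  case False
  then show ?thesis
    using assms \<beta>_nz \<mu>_nz by (auto simp: inverse_kernel_def)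
qed

text \<open>The mirror image, with cancellation below the diagonal by
  \<open>shift_ratio_Suc\<close>. On the diagonal only the second term is present, and
  \<open>\<alpha>\<close> cancels against \<open>\<beta>\<close> and the quotient of
  \<open>\<mu>\<close>.\<close>

lemma inverse_kernel_step_neg:
  assumes n: "n = - int (Suc d)"
  shows "(if k = 0 then 0 else \<beta> (k - 1) * inverse_kernel \<beta> \<mu> n (k - 1) j)
    - \<alpha> (k + d) * inverse_kernel \<beta> \<mu> n k j = (if j = k then 1 else 0)"
proof -
  have K: "inverse_kernel \<beta> \<mu> n k j =
      (if j \<le> k then - (shift_ratio \<beta> d j (k - j) / \<beta> (k + d) * (\<mu> (j + d) / \<mu> (k + d + 1))) else 0)"
    for k
  proof -
    have "nat (- n) - 1 = d" "\<not> n \<ge> 0" using n by auto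
    then show ?thesis by (simp add: inverse_kernel_def)
  qed
  show ?thesis
  proof (cases "j < k")
    case True
    then obtain l where k: "k = Suc (j + l)"
      by (metis less_iff_Suc_add)
    then have "k - j = Suc l" "k - 1 - j = l" "k - 1 = j + l" "j \<le> k - 1" "k \<noteq> 0" by auto
    then show ?thesis
      using True \<beta>_nz \<mu>_nz by (simp add: K shift_ratio_Suc \<alpha>_eq k add_ac)
  next
    case False
    then show ?thesis
      using \<beta>_nz \<mu>_nz by (auto simp: K \<alpha>_eq)
  qed
qed

abbreviation "Q\<^sub>0 \<equiv> kernel_op 1 (inverse_kernel \<beta> \<mu>)"
abbreviation "P \<equiv> kernel_op 0 (projection_kernel w \<alpha> \<beta> N)"

lemma D_op_Q0:
  assumes g: "g \<in> H_space w'"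
  shows "D_op \<alpha> \<beta> (Q\<^sub>0 g) = g"
proof (intro ext)
  fix m :: int and k
  define n where "n = m - 1"
  have m: "m = n + 1" by (simp add: n_def)
  note row = kernel_row_summable[OF w' w density_summable g]
  show "D_op \<alpha> \<beta> (Q\<^sub>0 g) m k = g m k"
  proof (cases "n \<ge> 0")
    case True
    have "D_op \<alpha> \<beta> (Q\<^sub>0 g) m k = (\<Sum>\<^sub>\<infinity>j. \<beta> (k + nat n) * (inverse_kernel \<beta> \<mu> n k j * g (n + 1) j)
        - \<alpha> k * (inverse_kernel \<beta> \<mu> n (k + 1) j * g (n + 1) j))"
      unfolding m D_op_nonneg[OF True] kernel_op_def by (rule infsum_linear_combination[OF row row])
    also have "\<dots> = (\<Sum>\<^sub>\<infinity>j. (if j = k then 1 else 0) * g m j)"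
      unfolding inverse_kernel_step_nonneg[OF True, symmetric] m
      by (intro infsum_cong) (simp add: algebra_simps)
    finally show ?thesis by (simp only: infsum_delta)
  next
    case False
    define d where "d = nat (- n) - 1"
    have n: "n = - int (Suc d)" and d: "k + nat (- n) - 1 = k + d" using False by (auto simp: d_def)
    \<comment> \<open>The case \<open>k = 0\<close> is moved into the coefficient so that both rows
      can be summed together; the row \<open>k - 1\<close> is then row 0 with coefficient 0.\<close>
    have "D_op \<alpha> \<beta> (Q\<^sub>0 g) m k
        = (if k = 0 then 0 else \<beta> (k - 1)) * (\<Sum>\<^sub>\<infinity>j. inverse_kernel \<beta> \<mu> n (k - 1) j * g (n + 1) j)
          - \<alpha> (k + d) * (\<Sum>\<^sub>\<infinity>j. inverse_kernel \<beta> \<mu> n k j * g (n + 1) j)"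
      using D_op_neg[of n \<alpha> \<beta> "Q\<^sub>0 g" k] False unfolding m d kernel_op_def by simp
    also have "\<dots> = (\<Sum>\<^sub>\<infinity>j. (if k = 0 then 0 else \<beta> (k - 1)) * (inverse_kernel \<beta> \<mu> n (k - 1) j * g (n + 1) j)
          - \<alpha> (k + d) * (inverse_kernel \<beta> \<mu> n k j * g (n + 1) j))"
      by (rule infsum_linear_combination[OF row row])
    also have "\<dots> = (\<Sum>\<^sub>\<infinity>j. (if j = k then 1 else 0) * g m j)"
      unfolding inverse_kernel_step_neg[OF n, symmetric] m
      by (intro infsum_cong) (simp add: algebra_simps)
    finally show ?thesis by (simp only: infsum_delta)
  qed
qed

section \<open>The kernel of \<open>D\<close> and its projection\<close>

lemma kernel_vector_Suc:
  "\<alpha> k * kernel_vector \<alpha> \<beta> n (Suc k) = \<beta> (k + nat n) * kernel_vector \<alpha> \<beta> n k"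
  using \<alpha>_nz by (simp add: kernel_vector_def)

lemma kernel_vector_0 [simp]: "kernel_vector \<alpha> \<beta> n 0 = 1"
  by (simp add: kernel_vector_def)

text \<open>By (iv) the product of the \<open>\<alpha> i\<close> is that of the
  \<open>\<beta> i\<close> times \<open>\<mu> k\<close>, and the quotient of the
  \<open>\<beta>\<close> products telescopes. What remains has \<open>n\<close> factors instead of
  \<open>k\<close>, which shows the growth in \<open>k\<close>.\<close>

lemma kernel_vector_eq:
  "kernel_vector \<alpha> \<beta> (int n) k = (\<Prod>i<n. \<beta> (k + i)) / (\<Prod>i<n. \<beta> i) / \<mu> k"
proof (induction k)
  case 0
  show ?case using \<beta>_nz by (simp add: \<mu>_0)
next
  case (Suc k)
  have p: "\<beta> k * (\<Prod>i<n. \<beta> (Suc k + i)) = (\<Prod>i<n. \<beta> (k + i)) * \<beta> (k + n)"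
    using prod.lessThan_Suc[of "\<lambda>i. \<beta> (k + i)" n] prod.lessThan_Suc_shift[of "\<lambda>i. \<beta> (k + i)" n]
    by simp
  have "\<alpha> k * kernel_vector \<alpha> \<beta> (int n) (Suc k)
      = \<beta> k * (\<Prod>i<n. \<beta> (Suc k + i)) / (\<Prod>i<n. \<beta> i) / \<mu> k"
    unfolding kernel_vector_Suc Suc.IH p by simp
  also have "\<dots> = \<alpha> k * ((\<Prod>i<n. \<beta> (Suc k + i)) / (\<Prod>i<n. \<beta> i) / \<mu> (Suc k))"
    using \<mu>_nz by (simp add: \<alpha>_eq)
  finally show ?case using \<alpha>_nz[of k] by (simp only: mult_cancel_left) blast
qed

text \<open>The two linear bounds on \<open>\<beta>\<close> make the kernel vector comparable to
  \<open>(1 + k)\<^sup>n / |\<mu> k|\<close> from both sides, with constants that depend on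
  \<open>n\<close> only, so (vii) decides.\<close>

lemma kernel_vector_summable_iff:
  "(\<lambda>k. w k * (cmod (kernel_vector \<alpha> \<beta> (int n) k))\<^sup>2) summable_on UNIV \<longleftrightarrow> n < N"
proof -
  have w0: "w k \<ge> 0" for k using w by (simp add: pos_weight_def less_imp_le)
  define L where "L = (\<Prod>i<n. cmod (\<beta> i))"
  have L: "L > 0" using \<beta>_nz by (auto simp: L_def intro: prod_pos)
  have B0: "B \<ge> 0" using order_trans[OF norm_ge_zero \<beta>_upper[of 0]] by simp
  have kv: "cmod (kernel_vector \<alpha> \<beta> (int n) k) = (\<Prod>i<n. cmod (\<beta> (k + i))) / L / cmod (\<mu> k)" for k
    by (simp add: kernel_vector_eq norm_divide norm_mult prod_norm[symmetric] L_def)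
  have low: "(c ^ n / L) * ((1 + real k) ^ n / cmod (\<mu> k)) \<le> cmod (kernel_vector \<alpha> \<beta> (int n) k)" for k
  proof -
    have "(\<Prod>i<n. c * (1 + real k)) \<le> (\<Prod>i<n. cmod (\<beta> (k + i)))"
    proof (intro prod_mono conjI)
      fix i
      have "c * (1 + real k) \<le> c * (real (k + i) + 1)" using c by simp
      then show "c * (1 + real k) \<le> cmod (\<beta> (k + i))" using \<beta>_lower[of "k + i"] by linarith
    qed (use c in auto)
    then have "(c * (1 + real k)) ^ n / L / cmod (\<mu> k) \<le> cmod (kernel_vector \<alpha> \<beta> (int n) k)"
      unfolding kv using L by (intro divide_right_mono) auto
    then show ?thesis by (simp add: power_mult_distrib)
  qed
  have up: "cmod (kernel_vector \<alpha> \<beta> (int n) k)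
      \<le> ((B * (1 + real n)) ^ n / L) * ((1 + real k) ^ n / cmod (\<mu> k))" for k
  proof -
    have "(\<Prod>i<n. cmod (\<beta> (k + i))) \<le> (\<Prod>i<n. B * (1 + real n) * (1 + real k))"
    proof (intro prod_mono conjI)
      fix i
      assume i: "i \<in> {..<n}"
      have "real (k + i) + 1 \<le> (1 + real n) * (1 + real k)"
        using i by (simp add: algebra_simps add_increasing2)
      then have "B * (real (k + i) + 1) \<le> B * ((1 + real n) * (1 + real k))"
        using B0 by (intro mult_left_mono)
      then show "cmod (\<beta> (k + i)) \<le> B * (1 + real n) * (1 + real k)"
        using \<beta>_upper[of "k + i"] by (simp add: mult.assoc)
    qed auto
    then have "cmod (kernel_vector \<alpha> \<beta> (int n) k)
        \<le> (B * (1 + real n) * (1 + real k)) ^ n / L / cmod (\<mu> k)"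
      unfolding kv using L by (intro divide_right_mono) auto
    then show ?thesis by (simp add: power_mult_distrib)
  qed
  let ?t = "\<lambda>k. (1 + real k) ^ (2 * n) / (cmod (\<mu> k))\<^sup>2 * w k"
  let ?v = "\<lambda>k. w k * (cmod (kernel_vector \<alpha> \<beta> (int n) k))\<^sup>2"
  have t: "?t k = w k * ((1 + real k) ^ n / cmod (\<mu> k))\<^sup>2" for k
    by (simp add: power_divide power_mult mult.commute[of 2 n])
  have v_low: "(c ^ n / L)\<^sup>2 * ?t k \<le> ?v k" for k
  proof -
    have "(c ^ n / L * ((1 + real k) ^ n / cmod (\<mu> k)))\<^sup>2 \<le> (cmod (kernel_vector \<alpha> \<beta> (int n) k))\<^sup>2"
      using c L by (intro power_mono low) auto
    from mult_left_mono[OF this w0[of k]] show ?thesis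
      unfolding t power_mult_distrib by (simp add: mult_ac)
  qed
  have v_up: "?v k \<le> ((B * (1 + real n)) ^ n / L)\<^sup>2 * ?t k" for k
  proof -
    have "(cmod (kernel_vector \<alpha> \<beta> (int n) k))\<^sup>2
        \<le> ((B * (1 + real n)) ^ n / L * ((1 + real k) ^ n / cmod (\<mu> k)))\<^sup>2"
      by (intro power_mono up) auto
    from mult_left_mono[OF this w0[of k]] show ?thesis
      unfolding t power_mult_distrib by (simp add: mult_ac)
  qed
  have "?v summable_on UNIV \<longleftrightarrow> summable ?v"
    using w0 by (intro summable_on_UNIV_nonneg_real_iff) auto
  also have "\<dots> \<longleftrightarrow> summable ?t"
  proof
    assume "summable ?v"
    then have "summable (\<lambda>k. (c ^ n / L)\<^sup>2 * ?t k)"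
      using v_low w0 by (rule_tac summable_comparison_test'[of ?v 0]) auto
    then show "summable ?t"
      using c L by (subst (asm) summable_cmult_iff) auto
  next
    assume "summable ?t"
    then have "summable (\<lambda>k. ((B * (1 + real n)) ^ n / L)\<^sup>2 * ?t k)"
      by (rule summable_mult)
    then show "summable ?v"
      using v_up w0 by (rule_tac summable_comparison_test'[of _ 0]) auto
  qed
  finally show ?thesis by (simp only: kernel_dim)
qed

lemma kernel_vector_sq_pos:
  assumes "n < N"
  shows "kernel_vector_sq w \<alpha> \<beta> (int n) > 0"
proof -
  \<comment> \<open>The vector is 1 at index 0, so this single term is already positive.\<close>
  have "(\<Sum>j\<in>{0}. w j * (cmod (kernel_vector \<alpha> \<beta> (int n) j))\<^sup>2) \<le> kernel_vector_sq w \<alpha> \<beta> (int n)"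
    unfolding kernel_vector_sq_def using assms w
    by (intro finite_sum_le_infsum) (auto simp: kernel_vector_summable_iff pos_weight_def less_imp_le)
  then show ?thesis using w by (simp add: pos_weight_def) (metis less_le_trans)
qed

lemma projection_kernel_HS: "vanishing_HS_blocks w w 0 (projection_kernel w \<alpha> \<beta> N)"
proof -
  let ?d = "kernel_density w w 0 (projection_kernel w \<alpha> \<beta> N)"
  have out: "?d n = (\<lambda>z. 0)" if "\<not> (0 \<le> n \<and> n < int N)" for n
    using that by (auto simp: kernel_density_def projection_kernel_def)
  have inn: "?d (int n) summable_on UNIV" if n: "n < N" for n
  proof -
    let ?p = "\<lambda>k. w k * (cmod (kernel_vector \<alpha> \<beta> (int n) k))\<^sup>2" and ?S = "kernel_vector_sq w \<alpha> \<beta> (int n)"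
    \<comment> \<open>The squared entry contains \<open>(w j)\<^sup>2\<close>; dividing by the
      source weight \<open>w j\<close> leaves one factor, and the density splits into a
      product.\<close>
    have d: "?d (int n) = (\<lambda>z. (1 / ?S\<^sup>2) * (case z of (k, j) \<Rightarrow> ?p k * ?p j))"
    proof (intro ext, clarify)
      fix k j
      have "w j > 0" using w by (simp add: pos_weight_def)
      then show "?d (int n) (k, j) = (1 / ?S\<^sup>2) * (?p k * ?p j)"
        using n kernel_vector_sq_pos[OF n]
        by (simp add: kernel_density_def projection_kernel_def H_weight_def norm_mult norm_divide
            power_mult_distrib power_divide power2_eq_square mult_ac)
    qed
    have "(\<lambda>(k, j). ?p k * ?p j) summable_on UNIV"
      using n w by (intro product_weight_sum)
        (auto simp: kernel_vector_summable_iff pos_weight_def less_imp_le)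
    then show ?thesis unfolding d by (rule summable_on_cmult_right)
  qed
  have "?d n summable_on UNIV" for n
    using out[of n] inn[of "nat n"] by (cases "0 \<le> n \<and> n < int N") auto
  moreover have "{n. \<epsilon> < infsum (?d n) UNIV} \<subseteq> {0..<int N}" if "\<epsilon> > 0" for \<epsilon>
    using out that by (force simp: not_le)
  ultimately show ?thesis
    unfolding vanishing_HS_blocks_def by (meson finite_atLeastLessThan_int finite_subset)
qed

lemma P_apply:
  "P f n k = (if 0 \<le> n \<and> n < int N then kernel_vector \<alpha> \<beta> n k *
    (\<Sum>\<^sub>\<infinity>j. cnj (kernel_vector \<alpha> \<beta> n j) * of_real (w j / kernel_vector_sq w \<alpha> \<beta> n) * f n j) else 0)"
proof (cases "0 \<le> n \<and> n < int N")
  case True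
  then show ?thesis
    unfolding kernel_op_def projection_kernel_def
    by (simp only: if_True simp_thms add_0_right mult.assoc infsum_cmult_right')
next
  case False
  then show ?thesis
    unfolding kernel_op_def projection_kernel_def by (simp only: if_False mult_zero_left infsum_0)
qed

lemma D_op_P: "D_op \<alpha> \<beta> (P f) = (\<lambda>n k. 0)"
proof (intro ext)
  fix m :: int and k
  define n where "n = m - 1"
  have m: "m = n + 1" by (simp add: n_def)
  show "D_op \<alpha> \<beta> (P f) m k = 0"
  proof (cases "n \<ge> 0")
    case True
    show ?thesis
      unfolding m D_op_nonneg[OF True] P_apply using kernel_vector_Suc[of k n] by simp
  next
    case False
    then show ?thesis
      unfolding m using D_op_neg[of n \<alpha> \<beta> "P f" k] by (simp add: P_apply)
  qed
qed

text \<open>For \<open>n < 0\<close> the equation at \<open>k = 0\<close> forces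
  \<open>u n 0 = 0\<close>, and the recursion carries this on. For \<open>n \<ge> 0\<close> the
  block is \<open>u n 0\<close> times the kernel vector: the projection reproduces it if
  \<open>n < N\<close>, and finiteness of the norm forces \<open>u n 0 = 0\<close>
  otherwise.\<close>

lemma P_fixes_kernel:
  assumes u: "u \<in> H_space w" and Du: "D_op \<alpha> \<beta> u = (\<lambda>n k. 0)"
  shows "P u = u"
proof (intro ext)
  fix n k
  show "P u n k = u n k"
  proof (cases "n \<ge> 0")
    case False
    have "u n k = 0"
    proof (induction k)
      case 0
      show ?case using D_op_neg[of n \<alpha> \<beta> u 0] False Du \<alpha>_nz by simp
    next
      case (Suc k)
      then show ?case using D_op_neg[of n \<alpha> \<beta> u "Suc k"] False Du \<alpha>_nz by simp
    qed
    then show ?thesis using False by (simp add: P_apply)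
  next
    case True
    define m where "m = nat n"
    have n: "n = int m" using True by (simp add: m_def)
    have u_eq: "u n k = u n 0 * kernel_vector \<alpha> \<beta> n k" for k
    proof (induction k)
      case (Suc k)
      have "\<alpha> k * u n (Suc k) = \<beta> (k + nat n) * u n k"
        using D_op_nonneg[OF True, of \<alpha> \<beta> u k] Du by simp
      also have "\<dots> = \<alpha> k * (u n 0 * kernel_vector \<alpha> \<beta> n (Suc k))"
        using kernel_vector_Suc[of k n] Suc by simp
      finally show ?case using \<alpha>_nz by simp
    qed simp
    let ?v = "kernel_vector \<alpha> \<beta> n" and ?S = "kernel_vector_sq w \<alpha> \<beta> n"
    show ?thesis
    proof (cases "m < N")
      case True
      then have S: "?S > 0" using kernel_vector_sq_pos n by simp
      have "((\<lambda>j. w j * (cmod (?v j))\<^sup>2) has_sum ?S) UNIV"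
        unfolding kernel_vector_sq_def using True n kernel_vector_summable_iff
        by (intro has_sum_infsum) simp
      then have S_sum: "(\<Sum>\<^sub>\<infinity>j. complex_of_real (w j * (cmod (?v j))\<^sup>2)) = of_real ?S"
        by (intro infsumI) (simp only: has_sum_of_real_iff)
      \<comment> \<open>The normalised inner product of \<open>u n 0\<close> times \<open>?v\<close>
        with \<open>?v\<close> recovers the coefficient \<open>u n 0\<close>.\<close>
      have "(\<Sum>\<^sub>\<infinity>j. cnj (?v j) * of_real (w j / ?S) * u n j)
          = (\<Sum>\<^sub>\<infinity>j. u n 0 / of_real ?S * of_real (w j * (cmod (?v j))\<^sup>2))"
        by (intro infsum_cong)
          (subst u_eq, simp add: complex_norm_square[symmetric] mult_ac flip: of_real_power)
      also have "\<dots> = u n 0 / of_real ?S * of_real ?S"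
        by (simp only: infsum_cmult_right' S_sum)
      finally have "(\<Sum>\<^sub>\<infinity>j. cnj (?v j) * of_real (w j / ?S) * u n j) = u n 0"
        using S by simp
      then show ?thesis
        unfolding P_apply using True n u_eq[of k] by simp
    next
      case False
      have "u n 0 = 0"
      proof (rule ccontr)
        assume nz: "u n 0 \<noteq> 0"
        have "(\<lambda>k. H_weight w n k * (cmod (u n k))\<^sup>2) summable_on UNIV"
          using summable_on_fibre[of "\<lambda>(n, k). H_weight w n k * (cmod (u n k))\<^sup>2" n] u
          by (simp add: H_space_def)
        also have "(\<lambda>k. H_weight w n k * (cmod (u n k))\<^sup>2)
            = (\<lambda>k. (cmod (u n 0))\<^sup>2 * (w k * (cmod (?v k))\<^sup>2))"
          by (subst u_eq) (simp add: n H_weight_def norm_mult power_mult_distrib mult_ac)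
        finally have "(\<lambda>k. w k * (cmod (?v k))\<^sup>2) summable_on UNIV"
          using nz by (subst (asm) summable_on_cmult_right') auto
        then show False
          using kernel_vector_summable_iff[of m] False n by simp
      qed
      then show ?thesis
        using u_eq[of k] False n by (simp add: P_apply)
    qed
  qed
qed

section \<open>Assembly of the parametrix\<close>

text \<open>\<open>DP = 0\<close> leaves \<open>DQ = DQ\<^sub>0 = I\<close>. For the other side,
  \<open>f - Q\<^sub>0Df\<close> lies in the kernel of \<open>D\<close> and is fixed by
  \<open>P\<close>; rearranging gives \<open>Q\<^sub>0Df - PQ\<^sub>0Df = f - Pf\<close>.\<close>

lemma parametrix_exists:
  shows "\<exists>Q C. compact_op w' w Q \<and> compact_op w w C \<and>
    (\<forall>g\<in>H_space w'. Q g \<in> D_dom w w' \<alpha> \<beta> \<and> D_op \<alpha> \<beta> (Q g) = g) \<and>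
    (\<forall>f\<in>D_dom w w' \<alpha> \<beta>. Q (D_op \<alpha> \<beta> f) = (\<lambda>n k. f n k - C f n k))"
proof (intro exI conjI ballI)
  let ?Q = "\<lambda>g n k. Q\<^sub>0 g n k - P (Q\<^sub>0 g) n k"
  show cQ: "compact_op w' w ?Q"
    by (rule kernel_op_minus_composition_compact[OF w' w inverse_kernel_HS projection_kernel_HS])
  show cP: "compact_op w w P"
    by (rule kernel_op_compact[OF w w projection_kernel_HS])
  have PH: "P f \<in> H_space w" if "f \<in> H_space w" for f
    using cP that by (simp add: compact_op_def linear_op_def)
  have Q0H: "Q\<^sub>0 g \<in> H_space w" if "g \<in> H_space w'" for g
    using kernel_op_linear[OF w' w inverse_kernel_HS] that by (simp add: linear_op_def)
  show DQ: "D_op \<alpha> \<beta> (?Q g) = g" if "g \<in> H_space w'" for g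
    unfolding D_op_diff D_op_Q0[OF that] D_op_P by simp
  show "?Q g \<in> D_dom w w' \<alpha> \<beta>" if g: "g \<in> H_space w'" for g
    unfolding D_dom_def mem_Collect_eq DQ[OF g]
    using H_space_diff[OF w Q0H[OF g] PH[OF Q0H[OF g]]] g by blast
  show "?Q (D_op \<alpha> \<beta> f) = (\<lambda>n k. f n k - P f n k)" if "f \<in> D_dom w w' \<alpha> \<beta>" for f
  proof -
    have f: "f \<in> H_space w" and Df: "D_op \<alpha> \<beta> f \<in> H_space w'"
      using that by (auto simp: D_dom_def)
    define h where "h = Q\<^sub>0 (D_op \<alpha> \<beta> f)"
    have h: "h \<in> H_space w" unfolding h_def by (rule Q0H[OF Df])
    have "D_op \<alpha> \<beta> (\<lambda>n k. f n k - h n k) = (\<lambda>n k. 0)"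
      unfolding D_op_diff h_def D_op_Q0[OF Df] by simp
    then have fix_u: "P (\<lambda>n k. f n k - h n k) = (\<lambda>n k. f n k - h n k)"
      by (rule P_fixes_kernel[OF H_space_diff[OF w f h]])
    have "P f = P (\<lambda>n k. h n k + (f n k - h n k))"
      by simp
    also have "\<dots> = (\<lambda>n k. P h n k + P (\<lambda>n k. f n k - h n k) n k)"
      using cP h H_space_diff[OF w f h] unfolding compact_op_def linear_op_def by meson
    finally have "P f = (\<lambda>n k. P h n k + (f n k - h n k))"
      unfolding fix_u .
    then show ?thesis
      unfolding h_def[symmetric] by simp
  qed
qed

end

theorem theorem4p1:
  fixes w w' :: "nat \<Rightarrow> real" and \<alpha> \<beta> \<mu> :: "nat \<Rightarrow> complex"
  assumes w_pos: "\<And>k. w k > 0" and w'_pos: "\<And>k. w' k > 0"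
    and w_sum: "w sums 1" and w'_sum: "w' sums 1"
    and i: "\<exists>b. ((\<lambda>k. \<beta> (k + 1) - \<beta> k) \<longlonglongrightarrow> b) \<and> b \<noteq> 0"
    and ii: "summable (\<lambda>k. (cmod (\<beta> k - \<alpha> k))\<^sup>2 * w' k)"
    and iii: "\<And>k. \<alpha> k \<noteq> 0" "\<And>k. \<beta> k \<noteq> 0"
    and iv: "\<mu> 0 = 1" "\<And>k. \<alpha> k = \<beta> k * (\<mu> (k + 1) / \<mu> k)"
    and v: "\<exists>M. \<forall>k j n. k \<le> j \<longrightarrow>
              cmod ((\<Prod>i\<le>n. \<beta> (k + i)) / (\<Prod>i\<le>n. \<beta> (j + i))) \<le> M"
    and vi: "(\<lambda>(k, j). 1 / (real (max j k) + 1)\<^sup>2 * (cmod (\<mu> j / \<mu> k))\<^sup>2 * (w k / w' j))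
               summable_on (UNIV :: (nat \<times> nat) set)"
    and vii: "\<exists>N :: nat. \<forall>n :: nat.
              (n < N \<longrightarrow> summable (\<lambda>k. (1 + real k) ^ (2 * n) / (cmod (\<mu> k))\<^sup>2 * w k)) \<and>
              (n \<ge> N \<longrightarrow> \<not> summable (\<lambda>k. (1 + real k) ^ (2 * n) / (cmod (\<mu> k))\<^sup>2 * w k))"
  shows "(\<exists>Q. compact_parametrix w w' \<alpha> \<beta> Q) \<and>
    (\<exists>Q C. compact_op w' w Q \<and> compact_op w w C \<and>
       (\<forall>g\<in>H_space w'. Q g \<in> D_dom w w' \<alpha> \<beta> \<and> D_op \<alpha> \<beta> (Q g) = g) \<and>
       (\<forall>f\<in>D_dom w w' \<alpha> \<beta>. Q (D_op \<alpha> \<beta> f) = (\<lambda>n k. f n k - C f n k)))"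
proof -
  obtain b where b: "(\<lambda>k. \<beta> (k + 1) - \<beta> k) \<longlonglongrightarrow> b" "b \<noteq> 0"
    using i by blast
  obtain c where c: "c > 0" "\<And>k. c * (real k + 1) \<le> cmod (\<beta> k)"
    using linear_growth(1)[OF b iii(2)] by blast
  obtain B where B: "\<And>k. cmod (\<beta> k) \<le> B * (real k + 1)"
    using linear_growth(2)[OF b iii(2)] by blast
  obtain M where M: "\<And>k j n. k \<le> j \<Longrightarrow>
      cmod ((\<Prod>i\<le>n. \<beta> (k + i)) / (\<Prod>i\<le>n. \<beta> (j + i))) \<le> M"
    using v by blast
  \<comment> \<open>(v) speaks of products with at least one factor; the maximum with 1 covers the
    empty product \<open>l = 0\<close>.\<close>
  have ratio: "cmod (shift_ratio \<beta> d k l) \<le> max M 1" for d k l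
  proof (cases l)
    case (Suc n)
    then have "{..<l} = {..n}" by auto
    then show ?thesis
      using M[of k "k + d" n] by (simp add: shift_ratio_def)
  qed simp
  obtain N where N: "\<And>n. summable (\<lambda>k. (1 + real k) ^ (2 * n) / (cmod (\<mu> k))\<^sup>2 * w k) \<longleftrightarrow> n < N"
    using vii by (metis not_le)
  \<comment> \<open>Division by zero yields 0, so \<open>\<mu> k = 0\<close> would make
    \<open>\<alpha> k\<close> zero.\<close>
  have \<mu>_nz: "\<mu> k \<noteq> 0" for k
    using iv(2)[of k] iii(1)[of k] by auto
  interpret parametrix_data w w' \<alpha> \<beta> \<mu> c B "max M 1" N
    by unfold_locales
      (use w_pos w'_pos c B \<mu>_nz iv ratio vi N in \<open>simp_all add: pos_weight_def\<close>)
  obtain Q C where QC: "compact_op w' w Q" "compact_op w w C"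
    "\<forall>g\<in>H_space w'. Q g \<in> D_dom w w' \<alpha> \<beta> \<and> D_op \<alpha> \<beta> (Q g) = g"
    "\<forall>f\<in>D_dom w w' \<alpha> \<beta>. Q (D_op \<alpha> \<beta> f) = (\<lambda>n k. f n k - C f n k)"
    using parametrix_exists by metis
  \<comment> \<open>As \<open>DQ = I\<close> holds exactly, the remainder on
    \<open>H_space w'\<close> is the zero operator.\<close>
  have "compact_parametrix w w' \<alpha> \<beta> Q"
    unfolding compact_parametrix_def
    using QC zero_compact[OF w'] by (intro conjI exI[of _ "\<lambda>f n k. 0"] exI[of _ C]) auto
  then show ?thesis using QC by blast
qed

end
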